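(* Let $m,d\ge1$ and let $\{A^{[n]}_k\}_{1\le k\le d,\ n\ge 1}$ be complex $m\times m$ matrices, $A^{[n]}_k=(a^{[n]}_{k;ij})_{i,j}$, such that for each $n$ $$\sum_{k=1}^dA^{[n]}_kA^{[n]\dagger}_k=\mathbf 1_m .$$ Define linear maps $V^{[n]}_H:\mathcal H\to\mathcal H\otimes\mathcal H$ and $V^{[n]}_{H,O}:\mathcal H\to\mathcal H\otimes\mathcal K$ by $$V^{[n]}_H(e_i)=\sum_{j}\sqrt{\textstyle\sum_k|a^{[n]}_{k;ij}|^2}\;e_i\otimes e_j,\qquad V^{[n]}_{H,O}(e_i)=\sum_k\sqrt{\textstyle\sum_j|a^{[n]}_{k;ij}|^2}\;e_i\otimes|k\rangle,$$ where each $\sqrt{\,\cdot\,}$ denotes an arbitrary choice of complex number whose modulus is the nonnegative square root of its argument. Then $V^{[n]}_H$ and $V^{[n]}_{H,O}$ are partial isometries for every $n$, and the sequences $(V_H^{[n]})_n$, $(V_{H,O}^{[n]})_n$ define (for any initial state on $\mathcal B(\mathcal H)$) an entangled hidden Markov model on the algebra $\mathcal B_{H,O}=\bigotimes_{n\ge1}\big(\mathcal B(\mathcal H)\otimes\mathcal B(\mathcal K)\big)$.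
   Context: $\mathcal H$ is a complex Hilbert space of dimension $m$ with orthonormal basis $(e_i)_{1\le i\le m}$; $\mathcal K$ is a complex Hilbert space of dimension $d$ with orthonormal basis $(|k\rangle)_{1\le k\le d}$. $\mathcal B_{H,O}$ is the infinite C$^*$-tensor product of the algebras $\mathcal B_{H;n}\otimes\mathcal B_{O;n}$, $n\ge 1$, with $\mathcal B_{H;n}\cong\mathcal B(\mathcal H)$ and $\mathcal B_{O;n}\cong\mathcal B(\mathcal K)$. Entangled hidden Markov model (EHMM): suppose that for every $n\ge1$ there are complex numbers $U^{[n]}_{ij}$ and $\chi^{[n]}_i(k)$ such that $(|U^{[n]}_{ij}|^2)_{i,j}$ is an $m\times m$ (row-)stochastic matrix and $(|\chi^{[n]}_i(k)|^2)_{i,k}$ is an $m\times d$ (row-)stochastic matrix, and $$V_H^{[n]}e_i=\sum_jU^{[n]}_{ij}\,e_i\otimes e_j,\qquad V_{H,O}^{[n]}e_i=\sum_k\chi^{[n]}_i(k)\,e_i\otimes|k\rangle .$$ Put $\mathcal E_{H;n}(X\otimes X')=V_H^{[n]\dagger}(X\otimes X')V_H^{[n]}$ for $X,X'\in\mathcal B(\mathcal H)$ (hidden transition expectation, a completely positive identity-preserving map $\mathcal B_{H;n}\otimes\mathcal B_{H;n+1}\to\mathcal B_{H;n}$) and $\mathcal E_{H,O;n}(X\otimes Y)=V_{H,O}^{[n]\dagger}(X\otimes Y)V_{H,O}^{[n]}$ for $X\in\mathcal B(\mathcal H)$, $Y\in\mathcal B(\mathcal K)$ (emission expectation, a completely positive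 identity-preserving map $\mathcal B_{H;n}\otimes\mathcal B_{O;n}\to\mathcal B_{H;n}$). Given an initial state $\varphi_1$ on $\mathcal B(\mathcal H)$, the EHMM defined by $(\varphi_1,(\mathcal E_{H;n})_n,(\mathcal E_{H,O;n})_n)$ is the unique state $\varphi_{H,O}$ on $\mathcal B_{H,O}$ such that for all $n\ge 1$, $X_\ell\in\mathcal B(\mathcal H)$, $Y_\ell\in\mathcal B(\mathcal K)$, $$\varphi_{H,O}\Big(\bigotimes_{\ell=1}^n(X_\ell\otimes Y_\ell)\Big)=\varphi_1(Z_1),$$ where $Z_{n+1}=\mathbf 1_{\mathcal H}$ and $Z_\ell=\mathcal E_{H;\ell}\big(\mathcal E_{H,O;\ell}(X_\ell\otimes Y_\ell)\otimes Z_{\ell+1}\big)$ for $\ell=n,n-1,\dots,1$. Saying that the two sequences of maps $(V_H^{[n]})_n$, $(V_{H,O}^{[n]})_n$ define an EHMM means that, for every $n\ge1$, they are of the form $V_H^{[n]}e_i=\sum_jU^{[n]}_{ij}\,e_i\otimes e_j$ and $V_{H,O}^{[n]}e_i=\sum_k\chi^{[n]}_i(k)\,e_i\otimes|k\rangle$ with $(|U^{[n]}_{ij}|^2)_{i,j}$ and $(|\chi^{[n]}_i(k)|^2)_{i,k}$ (row-)stochastic, and that, for every initial state $\varphi_1$ on $\mathcal B(\mathcal H)$, a state $\varphi_{H,O}$ on $\mathcal B_{H,O}$ satisfying $\varphi_{H,O}\big(\bigotimes_{\ell=1}^n(X_\ell\otimes Y_\ell)\big)=\varphi_1(Z_1)$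 for all $n\ge1$, $X_\ell\in\mathcal B(\mathcal H)$, $Y_\ell\in\mathcal B(\mathcal K)$ exists and is unique. *)

theory Defs
  imports "HOL-Analysis.Analysis"
begin

text \<open>
  A Hilbert space of dimension \<open>m\<close> with a fixed orthonormal basis is \<open>complex ^ 'm\<close> with
  \<open>CARD('m) = m\<close> and basis \<open>axis i 1\<close>; the library norm on it is the Hilbert space norm.  Linear
  maps are identified with their matrices, so that \<open>complex ^ 'a ^ 'b\<close> are the linear maps from
  \<open>complex ^ 'a\<close> to \<open>complex ^ 'b\<close>.  The tensor product of \<open>complex ^ 'a\<close> and \<open>complex ^ 'b\<close> is
  \<open>complex ^ ('a \<times> 'b)\<close>.
\<close>

definition hinner :: "complex ^ 'a \<Rightarrow> complex ^ 'a \<Rightarrow> complex" where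
  "hinner x y = (\<Sum>i\<in>UNIV. cnj (x $ i) * y $ i)"

definition dagger :: "complex ^ 'a ^ 'b \<Rightarrow> complex ^ 'b ^ 'a" where
  "dagger M = (\<chi> i j. cnj (M $ j $ i))"

definition mscale :: "complex \<Rightarrow> complex ^ 'a ^ 'b \<Rightarrow> complex ^ 'a ^ 'b" where
  "mscale c M = (\<chi> i j. c * M $ i $ j)"

definition vtensor :: "complex ^ 'a \<Rightarrow> complex ^ 'b \<Rightarrow> complex ^ ('a \<times> 'b)" where
  "vtensor x y = (\<chi> p. x $ fst p * y $ snd p)"

definition mtensor ::
    "complex ^ 'a ^ 'c \<Rightarrow> complex ^ 'b ^ 'd \<Rightarrow> complex ^ ('a \<times> 'b) ^ ('c \<times> 'd)" where
  "mtensor X Y = (\<chi> p q. X $ fst p $ fst q * Y $ snd p $ snd q)"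

text \<open>Isometric on the orthogonal complement of the kernel.\<close>

definition partial_isometry :: "complex ^ 'a ^ 'b \<Rightarrow> bool" where
  "partial_isometry V \<longleftrightarrow>
    (\<forall>x. (\<forall>y. V *v y = 0 \<longrightarrow> hinner y x = 0) \<longrightarrow> norm (V *v x) = norm x)"

definition positive_matrix :: "complex ^ 'a ^ 'a \<Rightarrow> bool" where
  "positive_matrix X \<longleftrightarrow> (\<forall>x. hinner x (X *v x) \<in> \<real>\<^sub>\<ge>\<^sub>0)"

definition matrix_state :: "(complex ^ 'a ^ 'a \<Rightarrow> complex) \<Rightarrow> bool" where
  "matrix_state \<phi> \<longleftrightarrow>
    (\<forall>X Y. \<phi> (X + Y) = \<phi> X + \<phi> Y) \<and>
    (\<forall>c X. \<phi> (mscale c X) = c * \<phi> X) \<and>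
    (\<forall>X. positive_matrix X \<longrightarrow> \<phi> X \<in> \<real>\<^sub>\<ge>\<^sub>0) \<and>
    \<phi> (mat 1) = 1"

definition row_stochastic :: "real ^ 'c ^ 'r \<Rightarrow> bool" where
  "row_stochastic P \<longleftrightarrow> (\<forall>i j. 0 \<le> P $ i $ j) \<and> (\<forall>i. (\<Sum>j\<in>UNIV. P $ i $ j) = 1)"

text \<open>The index set is arbitrary, in particular it may be uncountable.\<close>

typedef 'a ell2 = "{f :: 'a \<Rightarrow> complex. (\<lambda>x. (cmod (f x))\<^sup>2) summable_on UNIV}"
  morphisms ell2_fun Abs_ell2
  by (rule exI[of _ "\<lambda>_. 0"]) simp

setup_lifting type_definition_ell2

lemma ell2_mult_abs_summable:
  fixes f g :: "'a \<Rightarrow> complex"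
  assumes "(\<lambda>x. (cmod (f x))\<^sup>2) summable_on A" "(\<lambda>x. (cmod (g x))\<^sup>2) summable_on A"
  shows "(\<lambda>x. norm (f x * g x)) summable_on A"
proof (rule abs_summable_product)
  show "(\<lambda>i. norm (f i * f i)) summable_on A" "(\<lambda>i. norm (g i * g i)) summable_on A"
    using assms by (simp_all add: norm_mult power2_eq_square)
qed

lemma ell2_mult_summable:
  fixes f g :: "'a \<Rightarrow> complex"
  assumes "(\<lambda>x. (cmod (f x))\<^sup>2) summable_on A" "(\<lambda>x. (cmod (g x))\<^sup>2) summable_on A"
  shows "(\<lambda>x. cnj (f x) * g x) summable_on A"
proof (rule abs_summable_summable)
  show "(\<lambda>x. norm (cnj (f x) * g x)) summable_on A"
    by (rule ell2_mult_abs_summable) (simp_all add: assms)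
qed

lemma ell2_add_closed:
  fixes f g :: "'a \<Rightarrow> complex"
  assumes "(\<lambda>x. (cmod (f x))\<^sup>2) summable_on A" "(\<lambda>x. (cmod (g x))\<^sup>2) summable_on A"
  shows "(\<lambda>x. (cmod (f x + g x))\<^sup>2) summable_on A"
proof (rule summable_on_comparison_test)
  show "(\<lambda>x. 2 * (cmod (f x))\<^sup>2 + 2 * (cmod (g x))\<^sup>2) summable_on A"
    using assms by (intro summable_on_add summable_on_cmult_right)
  fix x
  have "(cmod (f x + g x))\<^sup>2 \<le> (cmod (f x) + cmod (g x))\<^sup>2"
    by (intro power_mono norm_triangle_ineq) simp
  also have "\<dots> \<le> 2 * (cmod (f x))\<^sup>2 + 2 * (cmod (g x))\<^sup>2"
    using sum_squares_bound[of "cmod (f x)" "cmod (g x)"] by (simp add: power2_sum)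
  finally show "(cmod (f x + g x))\<^sup>2 \<le> 2 * (cmod (f x))\<^sup>2 + 2 * (cmod (g x))\<^sup>2" .
qed simp

lemma ell2_scale_closed:
  fixes f :: "'a \<Rightarrow> complex"
  assumes "(\<lambda>x. (cmod (f x))\<^sup>2) summable_on A"
  shows "(\<lambda>x. (cmod (c * f x))\<^sup>2) summable_on A"
  using assms by (simp add: norm_mult power_mult_distrib summable_on_cmult_right)

lemma ell2_fun_summable: "(\<lambda>x. (cmod (ell2_fun \<psi> x))\<^sup>2) summable_on UNIV"
  using ell2_fun[of \<psi>] by simp

lift_definition scaleC_ell2 :: "complex \<Rightarrow> 'a ell2 \<Rightarrow> 'a ell2" is "\<lambda>c f x. c * f x"
  by (rule ell2_scale_closed)

lift_definition cinner :: "'a ell2 \<Rightarrow> 'a ell2 \<Rightarrow> complex" is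
  "\<lambda>f g. \<Sum>\<^sub>\<infinity>x. cnj (f x) * g x" .

instantiation ell2 :: (type) real_inner
begin

lift_definition zero_ell2 :: "'a ell2" is "\<lambda>_. 0" by simp
lift_definition plus_ell2 :: "'a ell2 \<Rightarrow> 'a ell2 \<Rightarrow> 'a ell2" is "\<lambda>f g x. f x + g x"
  by (rule ell2_add_closed)
lift_definition uminus_ell2 :: "'a ell2 \<Rightarrow> 'a ell2" is "\<lambda>f x. - f x" by simp
lift_definition minus_ell2 :: "'a ell2 \<Rightarrow> 'a ell2 \<Rightarrow> 'a ell2" is "\<lambda>f g x. f x - g x"
proof -
  fix f g :: "'a \<Rightarrow> complex"
  assume "(\<lambda>x. (cmod (f x))\<^sup>2) summable_on UNIV" "(\<lambda>x. (cmod (g x))\<^sup>2) summable_on UNIV"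
  then show "(\<lambda>x. (cmod (f x - g x))\<^sup>2) summable_on UNIV"
    using ell2_add_closed[of f UNIV "\<lambda>x. - g x"] by simp
qed
lift_definition scaleR_ell2 :: "real \<Rightarrow> 'a ell2 \<Rightarrow> 'a ell2" is "\<lambda>r f x. of_real r * f x"
  by (rule ell2_scale_closed)

definition inner_ell2 :: "'a ell2 \<Rightarrow> 'a ell2 \<Rightarrow> real" where
  "inner_ell2 \<psi> \<xi> = Re (cinner \<psi> \<xi>)"
definition norm_ell2 :: "'a ell2 \<Rightarrow> real" where
  "norm_ell2 \<psi> = sqrt (\<Sum>\<^sub>\<infinity>x. (cmod (ell2_fun \<psi> x))\<^sup>2)"
definition sgn_ell2 :: "'a ell2 \<Rightarrow> 'a ell2" where
  "sgn_ell2 \<psi> = inverse (norm \<psi>) *\<^sub>R \<psi>"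
definition dist_ell2 :: "'a ell2 \<Rightarrow> 'a ell2 \<Rightarrow> real" where
  "dist_ell2 \<psi> \<xi> = norm (\<psi> - \<xi>)"
definition uniformity_ell2 :: "('a ell2 \<times> 'a ell2) filter" where
  "uniformity_ell2 = (INF e\<in>{0 <..}. principal {(x, y). dist x y < e})"
definition open_ell2 :: "'a ell2 set \<Rightarrow> bool" where
  "open_ell2 U = (\<forall>x\<in>U. eventually (\<lambda>(x', y). x' = x \<longrightarrow> y \<in> U) uniformity)"

lemma cinner_self: "cinner \<psi> \<psi> = of_real (\<Sum>\<^sub>\<infinity>x. (cmod (ell2_fun \<psi> x))\<^sup>2)"
proof -
  have "cinner \<psi> \<psi> = (\<Sum>\<^sub>\<infinity>x. of_real ((cmod (ell2_fun \<psi> x))\<^sup>2))"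
    by (simp add: cinner.rep_eq complex_norm_square mult.commute del: of_real_power)
  also have "\<dots> = of_real (\<Sum>\<^sub>\<infinity>x. (cmod (ell2_fun \<psi> x))\<^sup>2)"
    by (intro infsumI has_sum_of_real has_sum_infsum ell2_fun_summable)
  finally show ?thesis .
qed

instance
proof
  fix x y z :: "'a ell2" and a b r :: real
  show "x + y + z = x + (y + z)" "x + y = y + x" "0 + x = x" "- x + x = 0" "x - y = x + - y"
    by (transfer; simp add: algebra_simps)+
  show "a *\<^sub>R (x + y) = a *\<^sub>R x + a *\<^sub>R y" "(a + b) *\<^sub>R x = a *\<^sub>R x + b *\<^sub>R x"
    "a *\<^sub>R b *\<^sub>R x = (a * b) *\<^sub>R x" "1 *\<^sub>R x = x"
    by (transfer; simp add: algebra_simps)+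
  show "sgn x = inverse (norm x) *\<^sub>R x" by (rule sgn_ell2_def)
  show "dist x y = norm (x - y)" by (rule dist_ell2_def)
  show "uniformity = (INF e\<in>{0 <..}. principal {(x, y :: 'a ell2). dist x y < e})"
    by (rule uniformity_ell2_def)
  show "open U = (\<forall>x\<in>U. eventually (\<lambda>(x', y). x' = x \<longrightarrow> y \<in> U) uniformity)" for U :: "'a ell2 set"
    by (rule open_ell2_def)
  have "cinner y x = cnj (cinner x y)"
    by (simp add: cinner.rep_eq mult.commute flip: infsum_cnj)
  then show "inner x y = inner y x" by (simp add: inner_ell2_def)
  have "cinner (x + y) z = cinner x z + cinner y z"
    by (simp add: cinner.rep_eq plus_ell2.rep_eq distrib_right infsum_add ell2_mult_summable
        ell2_fun_summable)
  then show "inner (x + y) z = inner x z + inner y z" by (simp add: inner_ell2_def)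
  have "cinner (r *\<^sub>R x) y = of_real r * cinner x y"
    by (simp add: cinner.rep_eq scaleR_ell2.rep_eq mult.assoc infsum_cmult_right')
  then show "inner (r *\<^sub>R x) y = r * inner x y" by (simp add: inner_ell2_def)
  show "0 \<le> inner x x" by (simp add: inner_ell2_def cinner_self infsum_nonneg)
  show "norm x = sqrt (inner x x)" by (simp add: inner_ell2_def cinner_self norm_ell2_def)
  show "inner x x = 0 \<longleftrightarrow> x = 0"
  proof
    assume "inner x x = 0"
    then have *: "(\<Sum>\<^sub>\<infinity>i. (cmod (ell2_fun x i))\<^sup>2) = 0"
      by (simp add: inner_ell2_def cinner_self)
    have "(cmod (ell2_fun x i))\<^sup>2 = 0" for i
      by (rule nonneg_infsum_le_0D[OF _ ell2_fun_summable]) (use * in auto)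
    then have "ell2_fun x = (\<lambda>_. 0)" by auto
    then show "x = 0" by transfer
  next
    assume "x = 0"
    then show "inner x x = 0" by (simp add: inner_ell2_def cinner_self zero_ell2.rep_eq)
  qed
qed

end

text \<open>
  The library type of bounded operators is that of bounded real-linear operators; all operators in
  the algebra defined below are complex-linear.
\<close>

lift_definition scaleC_op :: "complex \<Rightarrow> 'a ell2 \<Rightarrow>\<^sub>L 'a ell2" is scaleC_ell2
proof -
  fix c :: complex
  show "bounded_linear (scaleC_ell2 c :: 'a ell2 \<Rightarrow> 'a ell2)"
  proof (rule bounded_linear_intro[of _ "cmod c"])
    fix x y :: "'a ell2" and r :: real
    show "scaleC_ell2 c (x + y) = scaleC_ell2 c x + scaleC_ell2 c y"
      by transfer (simp add: algebra_simps)
    show "scaleC_ell2 c (r *\<^sub>R x) = r *\<^sub>R scaleC_ell2 c x"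
      by transfer (simp add: algebra_simps)
    show "norm (scaleC_ell2 c x) \<le> norm x * cmod c"
      by (simp add: norm_ell2_def scaleC_ell2.rep_eq norm_mult power_mult_distrib
          infsum_cmult_right' real_sqrt_mult)
  qed
qed

definition op_scaleC :: "complex \<Rightarrow> ('a ell2 \<Rightarrow>\<^sub>L 'a ell2) \<Rightarrow> ('a ell2 \<Rightarrow>\<^sub>L 'a ell2)" where
  "op_scaleC c T = scaleC_op c o\<^sub>L T"

definition positive_op :: "('a ell2 \<Rightarrow>\<^sub>L 'a ell2) \<Rightarrow> bool" where
  "positive_op T \<longleftrightarrow> (\<forall>\<psi>. cinner \<psi> (blinfun_apply T \<psi>) \<in> \<real>\<^sub>\<ge>\<^sub>0)"

text \<open>States on a unital C*-algebra of operators; only the values on the algebra matter.\<close>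

definition op_state :: "('a ell2 \<Rightarrow>\<^sub>L 'a ell2) set \<Rightarrow> (('a ell2 \<Rightarrow>\<^sub>L 'a ell2) \<Rightarrow> complex) \<Rightarrow> bool" where
  "op_state \<A> \<phi> \<longleftrightarrow>
    (\<forall>S\<in>\<A>. \<forall>T\<in>\<A>. \<phi> (S + T) = \<phi> S + \<phi> T) \<and>
    (\<forall>c. \<forall>T\<in>\<A>. \<phi> (op_scaleC c T) = c * \<phi> T) \<and>
    (\<forall>T\<in>\<A>. positive_op T \<longrightarrow> \<phi> T \<in> \<real>\<^sub>\<ge>\<^sub>0) \<and>
    \<phi> id_blinfun = 1"

text \<open>
  The infinite C*-tensor product of copies, indexed by \<open>nat\<close>, of the algebra of matrices
  \<open>complex ^ 's ^ 's\<close> is the completion of the union of the finite tensor products with respect to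
  its (unique) C*-norm.  It is realised here inside the bounded operators on the square-summable
  functions on \<^emph>\<open>all\<close> sequences \<open>\<omega> :: nat \<Rightarrow> 's\<close>: the tensor product of the first \<open>n\<close> copies is the
  algebra of matrices indexed by \<open>\<Pi>\<^sub>E l\<in>{..<n}. UNIV\<close>, acting on the coordinates below \<open>n\<close> and
  trivially on the others.  This representation is faithful, and no reference vector or reference
  state enters, so that the norm closure of the union is the C*-tensor product.
\<close>

lemma unit_act_bound:
  fixes f :: "(nat \<Rightarrow> 's) \<Rightarrow> complex" and n :: nat and \<xi> \<eta> :: "nat \<Rightarrow> 's"
  defines "g \<equiv> \<lambda>\<omega>. if \<forall>l<n. \<omega> l = \<xi> l then f (\<lambda>l. if l < n then \<eta> l else \<omega> l) else 0"
  assumes f: "(\<lambda>x. (cmod (f x))\<^sup>2) summable_on UNIV"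
  shows "(\<lambda>x. (cmod (g x))\<^sup>2) summable_on UNIV"
    and "(\<Sum>\<^sub>\<infinity>x. (cmod (g x))\<^sup>2) \<le> (\<Sum>\<^sub>\<infinity>x. (cmod (f x))\<^sup>2)"
proof -
  define D where "D = {\<omega> :: nat \<Rightarrow> 's. \<forall>l<n. \<omega> l = \<xi> l}"
  define h where "h = (\<lambda>\<omega> :: nat \<Rightarrow> 's. \<lambda>l. if l < n then \<eta> l else \<omega> l)"
  have inj: "inj_on h D"
  proof (rule inj_onI, rule ext)
    fix x y l assume "x \<in> D" "y \<in> D" "h x = h y"
    then show "x l = y l"
      by (cases "l < n") (auto simp: D_def h_def dest: fun_cong[of _ _ l])
  qed
  have gD: "g x = f (h x)" if "x \<in> D" for x using that by (auto simp: g_def D_def h_def)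
  have g0: "g x = 0" if "x \<notin> D" for x using that by (auto simp: g_def D_def)
  have im: "(\<lambda>x. (cmod (f x))\<^sup>2) summable_on h ` D"
    by (rule summable_on_subset_banach[OF f]) simp
  have "((\<lambda>x. (cmod (f x))\<^sup>2) \<circ> h) summable_on D"
    using im summable_on_reindex[OF inj] by blast
  then have "(\<lambda>x. (cmod (g x))\<^sup>2) summable_on D"
    by (rule summable_on_cong[THEN iffD1, rotated]) (simp add: gD)
  then show "(\<lambda>x. (cmod (g x))\<^sup>2) summable_on UNIV"
    by (rule summable_on_cong_neutral[THEN iffD1, rotated -1]) (auto simp: g0)
  have "(\<Sum>\<^sub>\<infinity>x. (cmod (g x))\<^sup>2) = (\<Sum>\<^sub>\<infinity>x\<in>D. (cmod (g x))\<^sup>2)"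
    by (rule infsum_cong_neutral) (auto simp: g0)
  also have "\<dots> = (\<Sum>\<^sub>\<infinity>x\<in>D. ((\<lambda>x. (cmod (f x))\<^sup>2) \<circ> h) x)"
    by (rule infsum_cong) (simp add: gD)
  also have "\<dots> = (\<Sum>\<^sub>\<infinity>x\<in>h ` D. (cmod (f x))\<^sup>2)"
    using infsum_reindex[OF inj, of "\<lambda>x. (cmod (f x))\<^sup>2"] by (simp add: o_def)
  also have "\<dots> \<le> (\<Sum>\<^sub>\<infinity>x. (cmod (f x))\<^sup>2)"
    by (rule infsum_mono_neutral[OF im f]) auto
  finally show "(\<Sum>\<^sub>\<infinity>x. (cmod (g x))\<^sup>2) \<le> (\<Sum>\<^sub>\<infinity>x. (cmod (f x))\<^sup>2)" .
qed

lift_definition unit_act :: "nat \<Rightarrow> (nat \<Rightarrow> 's) \<Rightarrow> (nat \<Rightarrow> 's) \<Rightarrow> (nat \<Rightarrow> 's) ell2 \<Rightarrow> (nat \<Rightarrow> 's) ell2"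
  is "\<lambda>n \<xi> \<eta> f \<omega>. if \<forall>l<n. \<omega> l = \<xi> l then f (\<lambda>l. if l < n then \<eta> l else \<omega> l) else 0"
  by (rule unit_act_bound)

text \<open>
  The matrix unit mapping the basis vector \<open>\<eta>\<close> of the first \<open>n\<close> tensor factors to \<open>\<xi>\<close>, tensored
  with the identity on the remaining ones.  Only the values of \<open>\<xi>\<close> and \<open>\<eta>\<close> below \<open>n\<close> matter.
\<close>

lift_definition matrix_unit ::
    "nat \<Rightarrow> (nat \<Rightarrow> 's) \<Rightarrow> (nat \<Rightarrow> 's) \<Rightarrow> (nat \<Rightarrow> 's) ell2 \<Rightarrow>\<^sub>L (nat \<Rightarrow> 's) ell2" is unit_act
proof -
  fix n and \<xi> \<eta> :: "nat \<Rightarrow> 's"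
  show "bounded_linear (unit_act n \<xi> \<eta>)"
  proof (rule bounded_linear_intro[of _ 1])
    fix x y :: "(nat \<Rightarrow> 's) ell2" and r :: real
    show "unit_act n \<xi> \<eta> (x + y) = unit_act n \<xi> \<eta> x + unit_act n \<xi> \<eta> y"
      by (auto simp: unit_act.rep_eq plus_ell2.rep_eq fun_eq_iff simp flip: ell2_fun_inject)
    show "unit_act n \<xi> \<eta> (r *\<^sub>R x) = r *\<^sub>R unit_act n \<xi> \<eta> x"
      by (auto simp: unit_act.rep_eq scaleR_ell2.rep_eq fun_eq_iff simp flip: ell2_fun_inject)
    show "norm (unit_act n \<xi> \<eta> x) \<le> norm x * 1"
      using unit_act_bound(2)[OF ell2_fun_summable[of x], of n \<xi> \<eta>]
      by (simp add: norm_ell2_def unit_act.rep_eq)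
  qed
qed

abbreviation configs :: "nat \<Rightarrow> (nat \<Rightarrow> 's) set" where
  "configs n \<equiv> (\<Pi>\<^sub>E l\<in>{..<n}. UNIV)"

definition local_op ::
    "nat \<Rightarrow> ((nat \<Rightarrow> 's) \<Rightarrow> (nat \<Rightarrow> 's) \<Rightarrow> complex) \<Rightarrow> (nat \<Rightarrow> 's) ell2 \<Rightarrow>\<^sub>L (nat \<Rightarrow> 's) ell2" where
  "local_op n a = (\<Sum>\<xi>\<in>configs n. \<Sum>\<eta>\<in>configs n. op_scaleC (a \<xi> \<eta>) (matrix_unit n \<xi> \<eta>))"

definition infinite_tensor_algebra :: "((nat \<Rightarrow> 's::finite) ell2 \<Rightarrow>\<^sub>L (nat \<Rightarrow> 's) ell2) set" where
  "infinite_tensor_algebra = closure (\<Union>n. range (local_op n))"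

text \<open>The tensor product of \<open>M 0, \<dots>, M (n - 1)\<close> (and the identity at all other sites).\<close>

definition elementary_tensor ::
    "nat \<Rightarrow> (nat \<Rightarrow> complex ^ 's ^ 's) \<Rightarrow> (nat \<Rightarrow> 's::finite) ell2 \<Rightarrow>\<^sub>L (nat \<Rightarrow> 's) ell2" where
  "elementary_tensor n M = local_op n (\<lambda>\<xi> \<eta>. \<Prod>l<n. M l $ \<xi> l $ \<eta> l)"

text \<open>
  Sites are numbered from \<open>0\<close>, so the index \<open>l :: nat\<close> stands for the site \<open>l + 1\<close> of the usual
  numbering by positive integers.
\<close>

definition transition_expectation :: "complex ^ 'a ^ 'b \<Rightarrow> complex ^ 'b ^ 'b \<Rightarrow> complex ^ 'a ^ 'a" where
  "transition_expectation V M = dagger V ** M ** V"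

text \<open>\<open>ehmm_Z VH VHO X Y l r\<close> is \<open>Z\<^sub>l\<close> for the product over the sites below \<open>n = l + r\<close>.\<close>

fun ehmm_Z ::
    "(nat \<Rightarrow> complex ^ 'm ^ ('m \<times> 'm)) \<Rightarrow> (nat \<Rightarrow> complex ^ 'm ^ ('m \<times> 'd)) \<Rightarrow>
     (nat \<Rightarrow> complex ^ 'm ^ 'm) \<Rightarrow> (nat \<Rightarrow> complex ^ 'd ^ 'd) \<Rightarrow> nat \<Rightarrow> nat \<Rightarrow> complex ^ 'm ^ 'm"
where
  "ehmm_Z VH VHO X Y l 0 = mat 1"
| "ehmm_Z VH VHO X Y l (Suc r) =
     transition_expectation (VH l)
       (mtensor (transition_expectation (VHO l) (mtensor (X l) (Y l)))
                (ehmm_Z VH VHO X Y (Suc l) r))"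

definition is_ehmm_state ::
    "(nat \<Rightarrow> complex ^ 'm ^ ('m \<times> 'm)) \<Rightarrow> (nat \<Rightarrow> complex ^ 'm ^ ('m \<times> 'd)) \<Rightarrow>
     (complex ^ 'm ^ 'm \<Rightarrow> complex) \<Rightarrow>
     ((nat \<Rightarrow> 'm::finite \<times> 'd::finite) ell2 \<Rightarrow>\<^sub>L (nat \<Rightarrow> 'm \<times> 'd) ell2 \<Rightarrow> complex) \<Rightarrow> bool"
where
  "is_ehmm_state VH VHO \<phi>\<^sub>1 \<phi> \<longleftrightarrow>
    op_state infinite_tensor_algebra \<phi> \<and>
    (\<forall>n\<ge>1. \<forall>X Y. \<phi> (elementary_tensor n (\<lambda>l. mtensor (X l) (Y l))) = \<phi>\<^sub>1 (ehmm_Z VH VHO X Y 0 n))"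

definition defines_ehmm ::
    "(nat \<Rightarrow> complex ^ 'm::finite ^ ('m \<times> 'm)) \<Rightarrow> (nat \<Rightarrow> complex ^ 'm ^ ('m \<times> 'd::finite)) \<Rightarrow> bool"
where
  "defines_ehmm VH VHO \<longleftrightarrow>
    (\<forall>n. \<exists>U.
       row_stochastic (\<chi> i j. (cmod (U $ i $ j))\<^sup>2) \<and>
       (\<forall>i. VH n *v axis i 1 = (\<Sum>j\<in>UNIV. U $ i $ j *s vtensor (axis i 1) (axis j 1)))) \<and>
    (\<forall>n. \<exists>C.
       row_stochastic (\<chi> i k. (cmod (C $ i $ k))\<^sup>2) \<and>
       (\<forall>i. VHO n *v axis i 1 = (\<Sum>k\<in>UNIV. C $ i $ k *s vtensor (axis i 1) (axis k 1)))) \<and>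
    (\<forall>\<phi>\<^sub>1. matrix_state \<phi>\<^sub>1 \<longrightarrow>
       (\<exists>\<phi>. is_ehmm_state VH VHO \<phi>\<^sub>1 \<phi> \<and>
         (\<forall>\<phi>'. is_ehmm_state VH VHO \<phi>\<^sub>1 \<phi>' \<longrightarrow> (\<forall>T\<in>infinite_tensor_algebra. \<phi>' T = \<phi> T))))"

end

theory Submission
  imports Defs
begin

text \<open>
  Composing the emission and transition isometries of the first \<open>n\<close> sites gives an isometry
  from \<open>\<H>\<close> into \<open>(\<H> \<otimes> \<K>)\<^sup>n \<otimes> \<H>\<close>, whose matrix entries are sums over hidden paths.
  Compressing an operator by it and applying \<open>\<phi>\<^sub>1\<close> is a state \<open>\<phi>\<^sub>n\<close> on the whole algebra,
  and since each site contributes an identity-preserving map, the values of \<open>\<phi>\<^sub>n\<close> on operators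
  localised in the first \<open>p\<close> sites do not depend on \<open>n \<ge> p\<close>.  States are bounded, so
  \<open>lim \<phi>\<^sub>n\<close> exists on the norm closure; positivity passes to the limit without any
  approximation by positive local operators.  Boundedness also gives uniqueness, because matrix
  units are elementary tensors.
\<close>

section \<open>The Hilbert space of square-summable functions\<close>

lemma ell2_eqI: "(\<And>x. ell2_fun \<psi> x = ell2_fun \<xi> x) \<Longrightarrow> \<psi> = \<xi>"
  by (simp add: fun_eq_iff flip: ell2_fun_inject)

lemma cinner_summable: "(\<lambda>x. cnj (ell2_fun \<psi> x) * ell2_fun \<xi> x) summable_on UNIV"
  by (intro ell2_mult_summable ell2_fun_summable)

lemma cinner_commute: "cinner \<psi> \<xi> = cnj (cinner \<xi> \<psi>)"
  by (simp add: cinner.rep_eq mult.commute flip: infsum_cnj)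

lemma cinner_add_right: "cinner \<psi> (\<xi> + \<zeta>) = cinner \<psi> \<xi> + cinner \<psi> \<zeta>"
  by (simp add: cinner.rep_eq plus_ell2.rep_eq distrib_left infsum_add cinner_summable)

lemma cinner_add_left: "cinner (\<xi> + \<zeta>) \<psi> = cinner \<xi> \<psi> + cinner \<zeta> \<psi>"
  by (subst (1 2 3) cinner_commute) (simp add: cinner_add_right)

lemma cinner_scaleC_right: "cinner \<psi> (scaleC_ell2 c \<xi>) = c * cinner \<psi> \<xi>"
  by (simp add: cinner.rep_eq scaleC_ell2.rep_eq mult.left_commute infsum_cmult_right')

lemma cinner_scaleC_left: "cinner (scaleC_ell2 c \<xi>) \<psi> = cnj c * cinner \<xi> \<psi>"
  by (subst (1 2) cinner_commute) (simp add: cinner_scaleC_right)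

lemma cinner_zero_right [simp]: "cinner \<psi> 0 = 0"
  by (simp add: cinner.rep_eq zero_ell2.rep_eq)

lemma cinner_zero_left [simp]: "cinner 0 \<psi> = 0"
  by (simp add: cinner.rep_eq zero_ell2.rep_eq)

lemma cinner_sum_right: "cinner \<psi> (sum f F) = (\<Sum>i\<in>F. cinner \<psi> (f i))"
  by (induction F rule: infinite_finite_induct) (simp_all add: cinner_add_right)

lemma cinner_sum_left: "cinner (sum f F) \<psi> = (\<Sum>i\<in>F. cinner (f i) \<psi>)"
  by (induction F rule: infinite_finite_induct) (simp_all add: cinner_add_left)

lemma Re_cinner: "Re (cinner \<psi> \<xi>) = inner \<psi> \<xi>"
  by (simp add: inner_ell2_def)

text \<open>Since Im z = Re (-i z), continuity of the complex inner product reduces to that of the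
  real one. The bounded operator \<open>scaleC_op\<close> is used so that limits pass through the
  scalar multiplication.\<close>

lemma Im_cinner: "Im (cinner \<psi> \<xi>) = inner \<psi> (scaleC_op (- \<i>) \<xi>)"
  by (simp add: inner_ell2_def scaleC_op.rep_eq cinner_scaleC_right)

lemma cinner_eq_norm: "cinner \<psi> \<psi> = of_real ((norm \<psi>)\<^sup>2)"
  by (simp add: cinner_self norm_ell2_def infsum_nonneg)

lemma tendsto_cinner:
  assumes "(f \<longlongrightarrow> \<psi>) F" "(g \<longlongrightarrow> \<xi>) F"
  shows "((\<lambda>x. cinner (f x) (g x)) \<longlongrightarrow> cinner \<psi> \<xi>) F"
  unfolding tendsto_complex_iff Re_cinner Im_cinner
  by (intro conjI tendsto_intros assms)

lemma norm_ell2_coord_le: "cmod (ell2_fun \<psi> x) \<le> norm \<psi>"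
proof -
  have "(\<Sum>\<^sub>\<infinity>x\<in>{x}. (cmod (ell2_fun \<psi> x))\<^sup>2) \<le> (\<Sum>\<^sub>\<infinity>x. (cmod (ell2_fun \<psi> x))\<^sup>2)"
    by (rule infsum_mono_neutral) (auto simp: ell2_fun_summable)
  then show ?thesis
    by (auto simp: norm_ell2_def intro: real_le_rsqrt)
qed

text \<open>Completeness makes the bounded operators a Banach space, which
  \<open>adjoint_pair_limit\<close> needs. The candidate limit is the coordinatewise one; estimates
  on finite sets of coordinates, uniform in the set, extend to the whole sum.\<close>

instance ell2 :: (type) banach
proof
  fix X :: "nat \<Rightarrow> 'a ell2"
  assume X: "Cauchy X"
  have "Cauchy (\<lambda>n. ell2_fun (X n) x)" for x
  proof (rule metric_CauchyI)
    fix e :: real assume "e > 0"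
    then obtain N where N: "\<And>m n. m \<ge> N \<Longrightarrow> n \<ge> N \<Longrightarrow> dist (X m) (X n) < e"
      using metric_CauchyD[OF X] by blast
    have "dist (ell2_fun (X m) x) (ell2_fun (X n) x) \<le> dist (X m) (X n)" for m n
      using norm_ell2_coord_le[of "X m - X n" x] by (simp add: dist_norm minus_ell2.rep_eq)
    then show "\<exists>N. \<forall>m\<ge>N. \<forall>n\<ge>N. dist (ell2_fun (X m) x) (ell2_fun (X n) x) < e"
      using N by (meson le_less_trans)
  qed
  then have "\<forall>x. \<exists>l. (\<lambda>n. ell2_fun (X n) x) \<longlonglongrightarrow> l"
    using Cauchy_convergent convergent_def by blast
  then obtain f where f: "\<And>x. (\<lambda>n. ell2_fun (X n) x) \<longlonglongrightarrow> f x"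
    by metis
  \<comment> \<open>For a finite set of coordinates the Cauchy estimate survives the limit in
    \<open>m\<close>. The bound is used twice: with \<open>e = 1\<close> to show that
    \<open>f\<close> is square-summable, and with \<open>e / 2\<close> to obtain convergence in
    norm.\<close>
  have bnd: "(\<lambda>x. (cmod (ell2_fun (X n) x - f x))\<^sup>2) summable_on UNIV \<and>
      (\<Sum>\<^sub>\<infinity>x. (cmod (ell2_fun (X n) x - f x))\<^sup>2) \<le> e\<^sup>2"
    if N: "\<And>m. m \<ge> N \<Longrightarrow> dist (X n) (X m) < e" for n N e
  proof -
    have fin: "(\<Sum>x\<in>F. (cmod (ell2_fun (X n) x - f x))\<^sup>2) \<le> e\<^sup>2" if "finite F" for F
    proof (rule tendsto_le[OF _ tendsto_const])
      show "(\<lambda>m. \<Sum>x\<in>F. (cmod (ell2_fun (X n) x - ell2_fun (X m) x))\<^sup>2) \<longlonglongrightarrow>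
          (\<Sum>x\<in>F. (cmod (ell2_fun (X n) x - f x))\<^sup>2)"
        by (intro tendsto_intros f)
      have "(\<Sum>x\<in>F. (cmod (ell2_fun (X n) x - ell2_fun (X m) x))\<^sup>2) \<le> e\<^sup>2" if "m \<ge> N" for m
      proof -
        have "(\<Sum>x\<in>F. (cmod (ell2_fun (X n - X m) x))\<^sup>2) \<le> (norm (X n - X m))\<^sup>2"
          using finite_sum_le_infsum[OF ell2_fun_summable \<open>finite F\<close>, of "X n - X m"]
          by (simp add: norm_ell2_def infsum_nonneg)
        also have "\<dots> \<le> e\<^sup>2"
          using N[OF that] by (intro power_mono) (auto simp: dist_norm)
        finally show ?thesis by (simp add: minus_ell2.rep_eq)
      qed
      then show "\<forall>\<^sub>F m in sequentially.
          (\<Sum>x\<in>F. (cmod (ell2_fun (X n) x - ell2_fun (X m) x))\<^sup>2) \<le> e\<^sup>2"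
        using eventually_sequentially by blast
    qed simp
    have s: "(\<lambda>x. (cmod (ell2_fun (X n) x - f x))\<^sup>2) summable_on UNIV"
      by (rule nonneg_bdd_above_summable_on) (use fin in \<open>auto intro!: bdd_aboveI[of _ "e\<^sup>2"]\<close>)
    then show ?thesis
      using infsum_le_finite_sums[OF s] fin by blast
  qed
  obtain N where "\<And>m. m \<ge> N \<Longrightarrow> dist (X N) (X m) < 1"
    using metric_CauchyD[OF X, of 1] by auto
  then have "(\<lambda>x. (cmod (ell2_fun (X N) x - f x))\<^sup>2) summable_on UNIV"
    using bnd by blast
  \<comment> \<open>Here \<open>f\<close> is written as \<open>X N - (X N - f)\<close>, a difference
    of square-summable functions.\<close>
  then have "(\<lambda>x. (cmod (ell2_fun (X N) x + - 1 * (ell2_fun (X N) x - f x)))\<^sup>2) summable_on UNIV"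
    by (intro ell2_add_closed ell2_scale_closed ell2_fun_summable)
  then have "(\<lambda>x. (cmod (f x))\<^sup>2) summable_on UNIV"
    by simp
  then obtain L where L: "ell2_fun L = f"
    using Abs_ell2_inverse by blast
  have "X \<longlonglongrightarrow> L"
  proof (rule metric_LIMSEQ_I)
    fix e :: real assume "e > 0"
    then obtain N where N: "\<And>m n. m \<ge> N \<Longrightarrow> n \<ge> N \<Longrightarrow> dist (X m) (X n) < e / 2"
      using metric_CauchyD[OF X, of "e / 2"] by auto
    have "dist (X n) L < e" if "n \<ge> N" for n
    proof -
      have "(\<Sum>\<^sub>\<infinity>x. (cmod (ell2_fun (X n) x - f x))\<^sup>2) \<le> (e / 2)\<^sup>2"
        using bnd[of N n "e / 2"] N that by blast
      then have "dist (X n) L \<le> e / 2"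
        using \<open>e > 0\<close> real_sqrt_le_mono[of _ "(e / 2)\<^sup>2"]
        by (fastforce simp: dist_norm norm_ell2_def minus_ell2.rep_eq L)
      then show ?thesis using \<open>e > 0\<close> by linarith
    qed
    then show "\<exists>N. \<forall>n\<ge>N. dist (X n) L < e" by blast
  qed
  then show "convergent X" by (rule convergentI)
qed

section \<open>Complex multiples of operators and adjoints\<close>

lemma op_scaleC_apply: "op_scaleC c T \<psi> = scaleC_ell2 c (T \<psi>)"
  by (simp add: op_scaleC_def scaleC_op.rep_eq)

lemma op_scaleC_1: "op_scaleC 1 T = T"
  by (rule blinfun_eqI) (simp add: op_scaleC_apply ell2_eqI scaleC_ell2.rep_eq)

lemma op_scaleC_minus1: "op_scaleC (- 1) T = - T"
  by (rule blinfun_eqI)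
    (simp add: op_scaleC_apply ell2_eqI scaleC_ell2.rep_eq uminus_blinfun.rep_eq uminus_ell2.rep_eq)

lemma op_scaleC_0: "op_scaleC 0 T = 0"
  by (rule blinfun_eqI) (simp add: op_scaleC_apply ell2_eqI scaleC_ell2.rep_eq zero_ell2.rep_eq)

lemma norm_scaleC_ell2: "norm (scaleC_ell2 c \<psi>) = cmod c * norm \<psi>"
  by (simp add: norm_ell2_def scaleC_ell2.rep_eq norm_mult power_mult_distrib
      infsum_cmult_right' real_sqrt_mult)

lemma norm_op_scaleC_le: "norm (op_scaleC c T) \<le> cmod c * norm T"
  by (rule norm_blinfun_bound)
    (auto simp: op_scaleC_apply norm_scaleC_ell2 mult.assoc intro!: mult_left_mono norm_blinfun)

lemma tendsto_op_scaleC: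
  assumes "(f \<longlongrightarrow> T) F"
  shows "((\<lambda>x. op_scaleC c (f x)) \<longlongrightarrow> op_scaleC c T) F"
  unfolding op_scaleC_def by (intro tendsto_intros assms)

text \<open>A relation instead of an operation: operators of this type are only real-linear, and one
  that is not complex-linear has no adjoint for \<open>cinner\<close>. The pairs needed come from
  matrix units, linear combinations and limits.\<close>

definition adjoint_pair :: "('a ell2 \<Rightarrow>\<^sub>L 'a ell2) \<Rightarrow> ('a ell2 \<Rightarrow>\<^sub>L 'a ell2) \<Rightarrow> bool" where
  "adjoint_pair T B \<longleftrightarrow> (\<forall>\<psi> \<xi>. cinner \<psi> (T \<xi>) = cinner (B \<psi>) \<xi>)"

lemma adjoint_pairD: "adjoint_pair T B \<Longrightarrow> cinner \<psi> (T \<xi>) = cinner (B \<psi>) \<xi>"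
  by (simp add: adjoint_pair_def)

lemma adjoint_pair_add:
  "adjoint_pair S A \<Longrightarrow> adjoint_pair T B \<Longrightarrow> adjoint_pair (S + T) (A + B)"
  by (simp add: adjoint_pair_def plus_blinfun.rep_eq cinner_add_left cinner_add_right)

lemma adjoint_pair_scale: "adjoint_pair T B \<Longrightarrow> adjoint_pair (op_scaleC c T) (op_scaleC (cnj c) B)"
  by (simp add: adjoint_pair_def op_scaleC_apply cinner_scaleC_left cinner_scaleC_right)

lemma adjoint_pair_zero: "adjoint_pair 0 0"
  by (simp add: adjoint_pair_def)

lemma adjoint_pair_diff:
  assumes "adjoint_pair S A" "adjoint_pair T B"
  shows "adjoint_pair (S - T) (A - B)"
  using adjoint_pair_add[OF assms(1) adjoint_pair_scale[OF assms(2), of "- 1"]]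
  by (simp add: op_scaleC_minus1)

lemma adjoint_pair_sum:
  "(\<And>i. i \<in> F \<Longrightarrow> adjoint_pair (f i) (g i)) \<Longrightarrow> adjoint_pair (sum f F) (sum g F)"
  by (induction F rule: infinite_finite_induct) (simp_all add: adjoint_pair_add adjoint_pair_zero)

text \<open>The square of the norm of \<open>B \<psi>\<close> is the inner product of
  \<open>\<psi>\<close> with \<open>T (B \<psi>)\<close>; apply Cauchy-Schwarz and cancel one factor
  \<open>norm (B \<psi>)\<close>.\<close>

lemma adjoint_pair_norm_le:
  assumes "adjoint_pair T B"
  shows "norm B \<le> norm T"
proof (rule norm_blinfun_bound)
  fix \<psi>
  have "inner (B \<psi>) (B \<psi>) = inner \<psi> (T (B \<psi>))"
    using adjoint_pairD[OF assms, of \<psi> "B \<psi>"] by (simp flip: Re_cinner)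
  also have "\<dots> \<le> norm \<psi> * (norm T * norm (B \<psi>))"
    by (rule order.trans[OF norm_cauchy_schwarz]) (intro mult_left_mono norm_blinfun norm_ge_zero)
  finally have "norm (B \<psi>) * norm (B \<psi>) \<le> (norm T * norm \<psi>) * norm (B \<psi>)"
    by (simp add: mult_ac power2_eq_square flip: power2_norm_eq_inner)
  then show "norm (B \<psi>) \<le> norm T * norm \<psi>"
    by (cases "norm (B \<psi>) = 0") (auto simp: mult_le_cancel_right)
qed simp

text \<open>By \<open>adjoint_pair_norm_le\<close> on differences, the adjoints of a Cauchy sequence
  are again Cauchy. The defining identity then passes to the limit.\<close>

lemma adjoint_pair_limit:
  assumes "\<And>n. adjoint_pair (S n) (R n)" "S \<longlonglongrightarrow> T"
  shows "\<exists>B. R \<longlonglongrightarrow> B \<and> adjoint_pair T B"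
proof -
  have "Cauchy R"
  proof (rule metric_CauchyI)
    fix e :: real assume "e > 0"
    then obtain N where "\<forall>m\<ge>N. \<forall>n\<ge>N. dist (S m) (S n) < e"
      using metric_CauchyD[OF LIMSEQ_imp_Cauchy[OF assms(2)]] by blast
    moreover have "dist (R m) (R n) \<le> dist (S m) (S n)" for m n
      unfolding dist_norm by (intro adjoint_pair_norm_le adjoint_pair_diff assms)
    ultimately show "\<exists>N. \<forall>m\<ge>N. \<forall>n\<ge>N. dist (R m) (R n) < e"
      by (meson le_less_trans)
  qed
  then obtain B where B: "R \<longlonglongrightarrow> B"
    using Cauchy_convergent convergent_def by blast
  have "cinner \<psi> (T \<xi>) = cinner (B \<psi>) \<xi>" for \<psi> \<xi>
  proof (rule LIMSEQ_unique)
    show "(\<lambda>n. cinner \<psi> (S n \<xi>)) \<longlonglongrightarrow> cinner \<psi> (T \<xi>)"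
      by (intro tendsto_cinner tendsto_intros assms)
    show "(\<lambda>n. cinner \<psi> (S n \<xi>)) \<longlonglongrightarrow> cinner (B \<psi>) \<xi>"
      unfolding adjoint_pairD[OF assms(1)] by (intro tendsto_cinner tendsto_intros B)
  qed
  with B show ?thesis by (auto simp: adjoint_pair_def)
qed

section \<open>Local operators and states on the infinite tensor product\<close>

lemma ell2_fun_sum: "ell2_fun (sum f F) x = (\<Sum>i\<in>F. ell2_fun (f i) x)"
  by (induction F rule: infinite_finite_induct) (simp_all add: plus_ell2.rep_eq zero_ell2.rep_eq)

lemma finite_configs: "finite (configs n :: (nat \<Rightarrow> 's::finite) set)"
  by (simp add: finite_PiE)

lemma restrict_eq_config_iff:
  "\<xi> \<in> configs n \<Longrightarrow> (\<forall>l<n. \<omega> l = \<xi> l) \<longleftrightarrow> \<xi> = restrict \<omega> {..<n}"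
  by (auto simp: fun_eq_iff PiE_def extensional_def)

text \<open>Among the row indices only the restriction of \<open>\<omega>\<close> contributes, so
  one of the two sums collapses: the operator acts as the matrix \<open>a\<close> on the first
  \<open>n\<close> coordinates and keeps the others.\<close>

lemma local_op_apply:
  fixes a :: "(nat \<Rightarrow> 's::finite) \<Rightarrow> (nat \<Rightarrow> 's) \<Rightarrow> complex"
  shows "ell2_fun (local_op n a \<psi>) \<omega> =
    (\<Sum>\<eta>\<in>configs n. a (restrict \<omega> {..<n}) \<eta> * ell2_fun \<psi> (\<lambda>l. if l < n then \<eta> l else \<omega> l))"
proof -
  have "ell2_fun (local_op n a \<psi>) \<omega> = (\<Sum>\<eta>\<in>configs n. \<Sum>\<xi>\<in>configs n.
      a \<xi> \<eta> * (if \<forall>l<n. \<omega> l = \<xi> l then ell2_fun \<psi> (\<lambda>l. if l < n then \<eta> l else \<omega> l) else 0))"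
    by (subst sum.swap) (simp add: local_op_def blinfun.sum_left ell2_fun_sum op_scaleC_apply
        scaleC_ell2.rep_eq matrix_unit.rep_eq unit_act.rep_eq)
  also have "\<dots> = (\<Sum>\<eta>\<in>configs n. \<Sum>\<xi>\<in>configs n. if \<xi> = restrict \<omega> {..<n}
      then a \<xi> \<eta> * ell2_fun \<psi> (\<lambda>l. if l < n then \<eta> l else \<omega> l) else 0)"
    by (intro sum.cong refl, subst restrict_eq_config_iff, assumption) simp
  finally show ?thesis
    by (simp add: finite_configs)
qed

lemma sum_configs_Suc:
  fixes F :: "(nat \<Rightarrow> 's::finite) \<Rightarrow> 'b::comm_monoid_add"
  shows "(\<Sum>\<xi>\<in>configs (Suc n). F \<xi>) = (\<Sum>\<xi>\<in>configs n. \<Sum>c\<in>UNIV. F (\<xi>(n := c)))"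
  unfolding sum.cartesian_product
  by (rule sum.reindex_bij_witness[where i = "\<lambda>(\<xi>, c). \<xi>(n := c)"
        and j = "\<lambda>\<xi>. (restrict \<xi> {..<n}, \<xi> n)"])
    (auto simp: fun_eq_iff PiE_def extensional_def less_Suc_eq intro!: arg_cong[where f = F])

text \<open>Splits off the first site, whereas \<open>sum_configs_Suc\<close> splits off the last.
  The recursion for \<open>ehmm_Z\<close> consumes sites from the front, so its path expansion needs
  this form.\<close>

lemma sum_configs_Suc_shift:
  fixes F :: "(nat \<Rightarrow> 's::finite) \<Rightarrow> 'b::comm_monoid_add"
  shows "(\<Sum>\<xi>\<in>configs (Suc n). F \<xi>) = (\<Sum>c\<in>UNIV. \<Sum>\<xi>\<in>configs n. F (case_nat c \<xi>))"
  unfolding sum.cartesian_product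
  by (rule sum.reindex_bij_witness[where i = "\<lambda>(c, \<xi>). case_nat c \<xi>"
        and j = "\<lambda>\<xi>. (\<xi> 0, \<lambda>l. \<xi> (Suc l))"])
    (auto simp: fun_eq_iff PiE_def extensional_def split: nat.splits intro!: arg_cong[where f = F])

lemma local_op_cong:
  assumes "\<And>\<xi> \<eta>. \<xi> \<in> configs n \<Longrightarrow> \<eta> \<in> configs n \<Longrightarrow> a \<xi> \<eta> = b \<xi> \<eta>"
  shows "local_op n a = local_op n b"
  unfolding local_op_def using assms by (intro sum.cong refl) auto

text \<open>The matrix on the left is \<open>a\<close> tensored with the identity at site
  \<open>n\<close>. Hence the local algebras increase with the number of sites.\<close>

lemma local_op_Suc:
  fixes a :: "(nat \<Rightarrow> 's::finite) \<Rightarrow> (nat \<Rightarrow> 's) \<Rightarrow> complex"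
  shows "local_op (Suc n) (\<lambda>\<xi> \<eta>. a (restrict \<xi> {..<n}) (restrict \<eta> {..<n}) *
    (if \<xi> n = \<eta> n then 1 else 0)) = local_op n a"
proof (rule blinfun_eqI, rule ell2_eqI)
  fix \<psi> :: "(nat \<Rightarrow> 's) ell2" and \<omega> :: "nat \<Rightarrow> 's"
  have r: "restrict (\<eta>(n := c)) {..<n} = \<eta>" if "\<eta> \<in> configs n" for \<eta> and c :: 's
    using that by (auto simp: fun_eq_iff PiE_def extensional_def)
  have r': "restrict (restrict \<omega> {..<Suc n}) {..<n} = restrict \<omega> {..<n}"
    by auto
  \<comment> \<open>The Kronecker delta leaves only the summand with value \<open>\<omega> n\<close>
    at site \<open>n\<close>; writing this value there changes nothing.\<close>
  have s: "(\<lambda>l. if l < Suc n then (\<eta>(n := \<omega> n)) l else \<omega> l) = (\<lambda>l. if l < n then \<eta> l else \<omega> l)"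
    for \<eta>
    by (auto simp: fun_eq_iff less_Suc_eq)
  show "ell2_fun (local_op (Suc n) (\<lambda>\<xi> \<eta>. a (restrict \<xi> {..<n}) (restrict \<eta> {..<n}) *
    (if \<xi> n = \<eta> n then 1 else 0)) \<psi>) \<omega> = ell2_fun (local_op n a \<psi>) \<omega>" (is "?L = _")
  proof -
    have "?L = (\<Sum>\<eta>\<in>configs n. \<Sum>c\<in>UNIV. if c = \<omega> n then a (restrict \<omega> {..<n}) \<eta> *
        ell2_fun \<psi> (\<lambda>l. if l < Suc n then (\<eta>(n := c)) l else \<omega> l) else 0)"
      unfolding local_op_apply sum_configs_Suc
      by (intro sum.cong refl) (simp add: r r' del: restrict_restrict fun_upd_apply, simp)
    also have "\<dots> = (\<Sum>\<eta>\<in>configs n. a (restrict \<omega> {..<n}) \<eta> *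
        ell2_fun \<psi> (\<lambda>l. if l < Suc n then (\<eta>(n := \<omega> n)) l else \<omega> l))"
      by simp
    finally show ?thesis
      unfolding s local_op_apply .
  qed
qed

lemma local_op_mono:
  assumes "n \<le> k"
  shows "range (local_op n) \<subseteq>
    range (local_op k :: _ \<Rightarrow> (nat \<Rightarrow> 's::finite) ell2 \<Rightarrow>\<^sub>L (nat \<Rightarrow> 's) ell2)"
proof (rule lift_Suc_mono_le[where f = "\<lambda>n. range (local_op n)", OF _ assms])
  fix n
  have "local_op n a \<in> range (local_op (Suc n))" for a :: "(nat \<Rightarrow> 's) \<Rightarrow> (nat \<Rightarrow> 's) \<Rightarrow> complex"
    by (subst local_op_Suc[symmetric]) (rule rangeI)
  then show "range (local_op n) \<subseteq>
      range (local_op (Suc n) :: _ \<Rightarrow> (nat \<Rightarrow> 's) ell2 \<Rightarrow>\<^sub>L (nat \<Rightarrow> 's) ell2)"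
    by blast
qed

lemma elementary_tensor_Suc_one:
  assumes "M n = mat 1"
  shows "elementary_tensor (Suc n) M = elementary_tensor n M"
  unfolding elementary_tensor_def local_op_Suc[symmetric, of n]
  using assms by (intro local_op_cong) (simp add: mat_def)

lemma elementary_tensor_extend:
  assumes "\<And>l. p \<le> l \<Longrightarrow> M l = mat 1" "p \<le> n"
  shows "elementary_tensor n M = elementary_tensor p M"
  using assms(2) by (induction n rule: dec_induct) (simp_all add: elementary_tensor_Suc_one assms)

lemma elementary_tensor_cong:
  assumes "\<And>l. l < n \<Longrightarrow> M l = N l"
  shows "elementary_tensor n M = elementary_tensor n N"
  unfolding elementary_tensor_def using assms by (intro local_op_cong) simp

lemma local_op_add:
  fixes a :: "(nat \<Rightarrow> 's::finite) \<Rightarrow> (nat \<Rightarrow> 's) \<Rightarrow> complex"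
  shows "local_op n a + local_op n b = local_op n (\<lambda>\<xi> \<eta>. a \<xi> \<eta> + b \<xi> \<eta>)"
proof (rule blinfun_eqI, rule ell2_eqI)
  show "ell2_fun ((local_op n a + local_op n b) \<psi>) \<omega> =
      ell2_fun (local_op n (\<lambda>\<xi> \<eta>. a \<xi> \<eta> + b \<xi> \<eta>) \<psi>) \<omega>" for \<psi> \<omega>
    by (simp add: plus_blinfun.rep_eq plus_ell2.rep_eq local_op_apply distrib_right sum.distrib)
qed

lemma op_scaleC_local_op:
  fixes a :: "(nat \<Rightarrow> 's::finite) \<Rightarrow> (nat \<Rightarrow> 's) \<Rightarrow> complex"
  shows "op_scaleC c (local_op n a) = local_op n (\<lambda>\<xi> \<eta>. c * a \<xi> \<eta>)"
proof (rule blinfun_eqI, rule ell2_eqI)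
  show "ell2_fun (op_scaleC c (local_op n a) \<psi>) \<omega> =
      ell2_fun (local_op n (\<lambda>\<xi> \<eta>. c * a \<xi> \<eta>) \<psi>) \<omega>" for \<psi> \<omega>
    by (simp add: op_scaleC_apply scaleC_ell2.rep_eq local_op_apply sum_distrib_left mult.assoc)
qed

lemma local_op_0:
  "local_op 0 (\<lambda>_ _. 1) = (id_blinfun :: (nat \<Rightarrow> 's::finite) ell2 \<Rightarrow>\<^sub>L (nat \<Rightarrow> 's) ell2)"
  by (rule blinfun_eqI, rule ell2_eqI) (simp add: local_op_apply)

text \<open>A matrix unit is the tensor product of one-site matrix units. Values on elementary
  tensors therefore determine a linear functional on each local algebra.\<close>

lemma matrix_unit_eq_elementary_tensor:
  fixes \<xi> \<eta> :: "nat \<Rightarrow> 's::finite"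
  assumes "\<xi> \<in> configs n" "\<eta> \<in> configs n"
  shows "matrix_unit n \<xi> \<eta> =
    elementary_tensor n (\<lambda>l. \<chi> s t. if s = \<xi> l \<and> t = \<eta> l then 1 else 0)"
proof -
  \<comment> \<open>Members of \<open>configs n\<close> coincide once they agree below
    \<open>n\<close>, so the product of the one-site deltas is the delta of the whole sequences. The
    nested conditionals let the two sums collapse one after the other.\<close>
  have p: "(\<Prod>l<n. if \<xi>' l = \<xi> l \<and> \<eta>' l = \<eta> l then 1 else 0) =
      (if \<xi>' = \<xi> then if \<eta>' = \<eta> then 1 else 0 else (0::complex))"
    if "\<xi>' \<in> configs n" "\<eta>' \<in> configs n" for \<xi>' \<eta>'
  proof (cases "\<xi>' = \<xi> \<and> \<eta>' = \<eta>")
    case False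
    have "\<exists>l<n. \<not> (\<xi>' l = \<xi> l \<and> \<eta>' l = \<eta> l)"
    proof (rule ccontr)
      assume neg: "\<not> (\<exists>l<n. \<not> (\<xi>' l = \<xi> l \<and> \<eta>' l = \<eta> l))"
      have "\<xi>' = \<xi>"
        by (rule PiE_ext[OF that(1) assms(1)]) (use neg in blast)
      moreover have "\<eta>' = \<eta>"
        by (rule PiE_ext[OF that(2) assms(2)]) (use neg in blast)
      ultimately show False using False by blast
    qed
    then obtain l where l: "l < n" "\<not> (\<xi>' l = \<xi> l \<and> \<eta>' l = \<eta> l)"
      by blast
    have "(\<Prod>l<n. if \<xi>' l = \<xi> l \<and> \<eta>' l = \<eta> l then 1 else 0) = (0::complex)"
      by (rule prod_zero) (use l in auto)
    then show ?thesis using False by auto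
  qed auto
  have delta: "op_scaleC (if P then if Q then 1 else 0 else 0) T = (if P then if Q then T else 0 else 0)"
    for P Q and T :: "(nat \<Rightarrow> 's) ell2 \<Rightarrow>\<^sub>L (nat \<Rightarrow> 's) ell2"
    by (simp add: op_scaleC_0 op_scaleC_1)
  have "elementary_tensor n (\<lambda>l. \<chi> s t. if s = \<xi> l \<and> t = \<eta> l then 1 else 0) =
      local_op n (\<lambda>\<xi>' \<eta>'. if \<xi>' = \<xi> then if \<eta>' = \<eta> then 1 else 0 else 0)"
    unfolding elementary_tensor_def by (intro local_op_cong) (simp only: vec_lambda_beta p)
  also have "\<dots> = (\<Sum>\<xi>'\<in>configs n. if \<xi>' = \<xi> then
      (\<Sum>\<eta>'\<in>configs n. if \<eta>' = \<eta> then matrix_unit n \<xi>' \<eta>' else 0) else 0)"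
    unfolding local_op_def delta by (intro sum.cong refl) simp
  also have "\<dots> = matrix_unit n \<xi> \<eta>"
    using assms by (simp add: finite_configs)
  finally show ?thesis ..
qed

text \<open>Overwriting the first \<open>n\<close> coordinates by \<open>\<eta>\<close> maps the
  sequences beginning with \<open>\<xi>\<close> bijectively onto those beginning with
  \<open>\<eta>\<close>; overwriting by \<open>\<xi>\<close> is the inverse. Reindexing along this
  bijection moves the operator to the other side of the inner product.\<close>

lemma adjoint_pair_matrix_unit: "adjoint_pair (matrix_unit n \<xi> \<eta>) (matrix_unit n \<eta> \<xi>)"
  unfolding adjoint_pair_def
proof (intro allI)
  fix \<psi> \<zeta> :: "(nat \<Rightarrow> 'a) ell2"
  define D where "D = (\<lambda>\<xi> :: nat \<Rightarrow> 'a. {\<omega>. \<forall>l<n. \<omega> l = \<xi> l})"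
  define h where "h = (\<lambda>\<eta> \<omega> :: nat \<Rightarrow> 'a. \<lambda>l. if l < n then \<eta> l else \<omega> l)"
  have bij: "bij_betw (h \<eta>) (D \<xi>) (D \<eta>)"
    by (rule bij_betwI[where g = "h \<xi>"]) (auto simp: D_def h_def fun_eq_iff)
  have hh: "h \<xi> (h \<eta> \<omega>) = \<omega>" if "\<omega> \<in> D \<xi>" for \<omega>
    using that by (auto simp: D_def h_def fun_eq_iff)
  have "cinner \<psi> (matrix_unit n \<xi> \<eta> \<zeta>) =
      (\<Sum>\<^sub>\<infinity>\<omega>\<in>D \<xi>. cnj (ell2_fun \<psi> \<omega>) * ell2_fun \<zeta> (h \<eta> \<omega>))"
    unfolding cinner.rep_eq matrix_unit.rep_eq unit_act.rep_eq
    by (rule infsum_cong_neutral) (auto simp: D_def h_def)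
  also have "\<dots> = (\<Sum>\<^sub>\<infinity>\<omega>\<in>D \<xi>. cnj (ell2_fun \<psi> (h \<xi> (h \<eta> \<omega>))) * ell2_fun \<zeta> (h \<eta> \<omega>))"
    by (rule infsum_cong) (simp add: hh)
  also have "\<dots> = (\<Sum>\<^sub>\<infinity>\<omega>\<in>D \<eta>. cnj (ell2_fun \<psi> (h \<xi> \<omega>)) * ell2_fun \<zeta> \<omega>)"
    by (rule infsum_reindex_bij_betw[OF bij])
  also have "\<dots> = cinner (matrix_unit n \<eta> \<xi> \<psi>) \<zeta>"
    unfolding cinner.rep_eq matrix_unit.rep_eq unit_act.rep_eq
    by (rule infsum_cong_neutral) (auto simp: D_def h_def)
  finally show "cinner \<psi> (matrix_unit n \<xi> \<eta> \<zeta>) = cinner (matrix_unit n \<eta> \<xi> \<psi>) \<zeta>" .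
qed

lemma adjoint_pair_local_op: "adjoint_pair (local_op n a) (local_op n (\<lambda>\<xi> \<eta>. cnj (a \<eta> \<xi>)))"
proof -
  have "local_op n (\<lambda>\<xi> \<eta>. cnj (a \<eta> \<xi>)) =
      (\<Sum>\<xi>\<in>configs n. \<Sum>\<eta>\<in>configs n. op_scaleC (cnj (a \<xi> \<eta>)) (matrix_unit n \<eta> \<xi>))"
    unfolding local_op_def by (rule sum.swap)
  then show ?thesis
    unfolding local_op_def[of n a]
    by (simp add: adjoint_pair_sum adjoint_pair_scale adjoint_pair_matrix_unit)
qed

section \<open>Closure properties of the infinite tensor product\<close>

lemma local_op_in_algebra: "local_op n a \<in> infinite_tensor_algebra"
  unfolding infinite_tensor_algebra_def by (rule subsetD[OF closure_subset]) blast

lemma elementary_tensor_in_algebra: "elementary_tensor n M \<in> infinite_tensor_algebra"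
  unfolding elementary_tensor_def by (rule local_op_in_algebra)

lemma id_in_algebra: "id_blinfun \<in> infinite_tensor_algebra"
  unfolding local_op_0[symmetric] by (rule local_op_in_algebra)

lemma algebraE:
  assumes "T \<in> infinite_tensor_algebra"
  obtains p a where "(\<lambda>n. local_op (p n) (a n)) \<longlonglongrightarrow> T"
proof -
  obtain S where S: "\<And>n. S n \<in> (\<Union>p. range (local_op p))" "S \<longlonglongrightarrow> T"
    using assms unfolding infinite_tensor_algebra_def closure_sequential by blast
  then have "\<forall>n. \<exists>p a. S n = local_op p a" by blast
  then obtain p a where "\<And>n. S n = local_op (p n) (a n)" by metis
  then have "S = (\<lambda>n. local_op (p n) (a n))" by auto
  with S(2) that show thesis by simp
qed

lemma algebra_limit:
  assumes "\<And>n. S n \<in> infinite_tensor_algebra" "S \<longlonglongrightarrow> T"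
  shows "T \<in> infinite_tensor_algebra"
  using assms closed_sequentially[of infinite_tensor_algebra S T]
  by (simp add: infinite_tensor_algebra_def)

lemma algebra_scaleC:
  assumes "T \<in> infinite_tensor_algebra"
  shows "op_scaleC c T \<in> infinite_tensor_algebra"
proof -
  obtain p a where *: "(\<lambda>n. local_op (p n) (a n)) \<longlonglongrightarrow> T"
    by (rule algebraE[OF assms])
  show ?thesis
    by (rule algebra_limit[OF _ tendsto_op_scaleC[OF *]])
      (simp add: op_scaleC_local_op local_op_in_algebra)
qed

lemma algebra_add:
  assumes "S \<in> infinite_tensor_algebra" "T \<in> infinite_tensor_algebra"
  shows "S + T \<in> infinite_tensor_algebra"
proof -
  obtain p a where S: "(\<lambda>n. local_op (p n) (a n)) \<longlonglongrightarrow> S"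
    by (rule algebraE[OF assms(1)])
  obtain q b where T: "(\<lambda>n. local_op (q n) (b n)) \<longlonglongrightarrow> T"
    by (rule algebraE[OF assms(2)])
  show ?thesis
  proof (rule algebra_limit[OF _ tendsto_add[OF S T]])
    \<comment> \<open>The two local operators may live on different numbers of sites; both are moved
      to \<open>p n + q n\<close> sites before being added.\<close>
    fix n
    have "local_op (p n) (a n) \<in> range (local_op (p n + q n))"
      by (rule subsetD[OF local_op_mono[of "p n"]]) auto
    moreover have "local_op (q n) (b n) \<in> range (local_op (p n + q n))"
      by (rule subsetD[OF local_op_mono[of "q n"]]) auto
    ultimately obtain a' b' where "local_op (p n) (a n) = local_op (p n + q n) a'"
        "local_op (q n) (b n) = local_op (p n + q n) b'"
      by (elim rangeE)
    then show "local_op (p n) (a n) + local_op (q n) (b n) \<in> infinite_tensor_algebra"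
      by (simp only: local_op_add local_op_in_algebra)
  qed
qed

lemma algebra_diff:
  "S \<in> infinite_tensor_algebra \<Longrightarrow> T \<in> infinite_tensor_algebra \<Longrightarrow> S - T \<in> infinite_tensor_algebra"
  using algebra_add[OF _ algebra_scaleC[of T "- 1"], of S] by (simp add: op_scaleC_minus1)

text \<open>The conjugate transposes of approximating local operators converge, and their limit is
  the adjoint.\<close>

lemma algebra_adjoint:
  assumes "T \<in> infinite_tensor_algebra"
  obtains B where "B \<in> infinite_tensor_algebra" "adjoint_pair T B"
proof -
  obtain p a where S: "(\<lambda>n. local_op (p n) (a n)) \<longlonglongrightarrow> T"
    by (rule algebraE[OF assms])
  obtain B where B: "(\<lambda>n. local_op (p n) (\<lambda>\<xi> \<eta>. cnj (a n \<eta> \<xi>))) \<longlonglongrightarrow> B" "adjoint_pair T B"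
    using adjoint_pair_limit[OF adjoint_pair_local_op S] by auto
  from algebra_limit[OF local_op_in_algebra B(1)] B(2) show thesis
    by (rule that)
qed

text \<open>Not guaranteed by the operator type. It holds for local operators and survives limits;
  positivity of compressions relies on it.\<close>

lemma algebra_complex_linear:
  fixes T :: "(nat \<Rightarrow> 's::finite) ell2 \<Rightarrow>\<^sub>L (nat \<Rightarrow> 's) ell2"
  assumes "T \<in> infinite_tensor_algebra"
  shows "T (scaleC_ell2 c \<psi>) = scaleC_ell2 c (T \<psi>)"
proof -
  obtain p a where S: "(\<lambda>n. local_op (p n) (a n)) \<longlonglongrightarrow> T"
    by (rule algebraE[OF assms])
  have loc: "local_op p a (scaleC_op c \<psi>) = scaleC_op c (local_op p a \<psi>)" for p a
    by (rule ell2_eqI)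
      (simp add: scaleC_op.rep_eq scaleC_ell2.rep_eq local_op_apply sum_distrib_left mult.left_commute)
  have "T (scaleC_op c \<psi>) = scaleC_op c (T \<psi>)"
  proof (rule LIMSEQ_unique)
    show "(\<lambda>n. local_op (p n) (a n) (scaleC_op c \<psi>)) \<longlonglongrightarrow> T (scaleC_op c \<psi>)"
      by (intro tendsto_intros S)
    show "(\<lambda>n. local_op (p n) (a n) (scaleC_op c \<psi>)) \<longlonglongrightarrow> scaleC_op c (T \<psi>)"
      unfolding loc by (intro tendsto_intros S)
  qed
  then show ?thesis by (simp add: scaleC_op.rep_eq)
qed

section \<open>Boundedness and limits of states\<close>

lemma op_state_add:
  "op_state \<A> \<phi> \<Longrightarrow> S \<in> \<A> \<Longrightarrow> T \<in> \<A> \<Longrightarrow> \<phi> (S + T) = \<phi> S + \<phi> T"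
  and op_state_scaleC: "op_state \<A> \<phi> \<Longrightarrow> T \<in> \<A> \<Longrightarrow> \<phi> (op_scaleC c T) = c * \<phi> T"
  and op_state_nonneg: "op_state \<A> \<phi> \<Longrightarrow> T \<in> \<A> \<Longrightarrow> positive_op T \<Longrightarrow> \<phi> T \<in> \<real>\<^sub>\<ge>\<^sub>0"
  and op_state_id: "op_state \<A> \<phi> \<Longrightarrow> \<phi> id_blinfun = 1"
  by (auto simp: op_state_def)

text \<open>The quadratic form of \<open>T + B\<close> is twice the real part of that of
  \<open>T\<close>, so it is at most \<open>2 * norm T\<close> times the squared norm of the vector
  in modulus. Thus \<open>2 * norm T\<close> times the identity, plus or minus \<open>T + B\<close>,
  is positive, and so is its value under the state.\<close>

lemma op_state_hermitian_bound:
  assumes \<phi>: "op_state infinite_tensor_algebra \<phi>"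
    and alg: "T \<in> infinite_tensor_algebra" "B \<in> infinite_tensor_algebra"
    and adj: "adjoint_pair T B"
  shows "cmod (\<phi> (T + B)) \<le> 2 * norm T"
proof -
  let ?R = "2 * norm T"
  have key: "of_real ?R + of_real s * \<phi> (T + B) \<in> \<real>\<^sub>\<ge>\<^sub>0" if s: "\<bar>s\<bar> = 1" for s
  proof -
    define P where "P = op_scaleC (of_real ?R) id_blinfun + op_scaleC (of_real s) (T + B)"
    have P: "P \<in> infinite_tensor_algebra"
      unfolding P_def by (intro algebra_add algebra_scaleC id_in_algebra alg)
    have "positive_op P"
      unfolding positive_op_def
    proof
      fix \<psi>
      have "cinner \<psi> (B \<psi>) = cnj (cinner \<psi> (T \<psi>))"
        by (subst cinner_commute) (simp add: adjoint_pairD[OF adj])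
      then have "cinner \<psi> (T \<psi>) + cinner \<psi> (B \<psi>) = of_real (2 * inner \<psi> (T \<psi>))"
        by (simp add: complex_add_cnj Re_cinner)
      then have "cinner \<psi> (P \<psi>) = of_real (2 * (norm T * (norm \<psi>)\<^sup>2 + s * inner \<psi> (T \<psi>)))"
        by (simp add: P_def plus_blinfun.rep_eq op_scaleC_apply cinner_add_right
            cinner_scaleC_right cinner_eq_norm algebra_simps)
      moreover have "\<bar>inner \<psi> (T \<psi>)\<bar> \<le> norm T * (norm \<psi>)\<^sup>2"
      proof -
        have "\<bar>inner \<psi> (T \<psi>)\<bar> \<le> norm \<psi> * (norm T * norm \<psi>)"
          by (rule order.trans[OF Cauchy_Schwarz_ineq2]) (intro mult_left_mono norm_blinfun norm_ge_zero)
        then show ?thesis by (simp add: power2_eq_square mult_ac)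
      qed
      then have "0 \<le> norm T * (norm \<psi>)\<^sup>2 + s * inner \<psi> (T \<psi>)"
        using s by (auto simp: abs_if split: if_splits)
      ultimately show "cinner \<psi> (P \<psi>) \<in> \<real>\<^sub>\<ge>\<^sub>0"
        by (metis nonneg_Reals_of_real_iff mult_nonneg_nonneg zero_le_numeral)
    qed
    then have "\<phi> P \<in> \<real>\<^sub>\<ge>\<^sub>0"
      using op_state_nonneg[OF \<phi> P] by blast
    moreover have "\<phi> P = of_real ?R + of_real s * \<phi> (T + B)"
      unfolding P_def
      by (simp add: op_state_add[OF \<phi>] op_state_scaleC[OF \<phi>] op_state_id[OF \<phi>]
          algebra_add algebra_scaleC id_in_algebra alg)
    ultimately show ?thesis by simp
  qed
  \<comment> \<open>Either sign forces the value to be real; the two signs together bound it from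
    both sides.\<close>
  have "Im (\<phi> (T + B)) = 0" "\<bar>Re (\<phi> (T + B))\<bar> \<le> ?R"
    using key[of 1] key[of "- 1"] by (auto simp: complex_nonneg_Reals_iff)
  then show ?thesis by (simp add: cmod_eq_Re)
qed

text \<open>Splits \<open>T\<close> into hermitian and skew-hermitian parts; the factor 2 is not optimal.\<close>

lemma op_state_bound:
  assumes \<phi>: "op_state infinite_tensor_algebra \<phi>" and T: "T \<in> infinite_tensor_algebra"
  shows "cmod (\<phi> T) \<le> 2 * norm T"
proof -
  obtain B where B: "B \<in> infinite_tensor_algebra" "adjoint_pair T B"
    by (rule algebra_adjoint[OF T])
  have 1: "cmod (\<phi> T + \<phi> B) \<le> 2 * norm T"
    using op_state_hermitian_bound[OF \<phi> T B] by (simp add: op_state_add[OF \<phi>] T B)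
  have "cmod (\<phi> (op_scaleC \<i> T + op_scaleC (cnj \<i>) B)) \<le> 2 * norm (op_scaleC \<i> T)"
    by (intro op_state_hermitian_bound \<phi> algebra_scaleC adjoint_pair_scale T B)
  moreover have "\<phi> (op_scaleC \<i> T + op_scaleC (cnj \<i>) B) = \<i> * (\<phi> T - \<phi> B)"
    by (simp add: op_state_add[OF \<phi>] op_state_scaleC[OF \<phi>] algebra_scaleC T B algebra_simps)
  moreover have "norm (op_scaleC \<i> T) \<le> norm T"
    using norm_op_scaleC_le[of \<i> T] by simp
  ultimately have 2: "cmod (\<phi> T - \<phi> B) \<le> 2 * norm T"
    by (simp add: norm_mult)
  have "cmod ((\<phi> T + \<phi> B) + (\<phi> T - \<phi> B)) \<le> 4 * norm T"
    by (rule order.trans[OF norm_triangle_ineq]) (use 1 2 in linarith)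
  then show ?thesis by (simp flip: mult_2)
qed

lemma op_state_dist_le:
  assumes \<phi>: "op_state infinite_tensor_algebra \<phi>"
    and "S \<in> infinite_tensor_algebra" "T \<in> infinite_tensor_algebra"
  shows "dist (\<phi> S) (\<phi> T) \<le> 2 * dist S T"
proof -
  have "\<phi> S = \<phi> (S - T) + \<phi> T"
    using op_state_add[OF \<phi>, of "S - T" T] assms(2,3) by (simp add: algebra_diff)
  then show ?thesis
    using op_state_bound[OF \<phi> algebra_diff[OF assms(2,3)]] by (simp add: dist_norm)
qed

lemma op_state_tendsto:
  assumes \<phi>: "op_state infinite_tensor_algebra \<phi>"
    and S: "\<And>n. S n \<in> infinite_tensor_algebra" "S \<longlonglongrightarrow> T"
  shows "(\<lambda>n. \<phi> (S n)) \<longlonglongrightarrow> \<phi> T"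
proof -
  have "(\<lambda>n. dist (S n) T) \<longlonglongrightarrow> 0"
    using S(2) by (simp add: tendsto_dist_iff[symmetric])
  moreover have "\<forall>\<^sub>F n in sequentially. norm (dist (\<phi> (S n)) (\<phi> T)) \<le> norm (dist (S n) T) * 2"
    using op_state_dist_le[OF \<phi> S(1) algebra_limit[OF S]] by (simp add: mult.commute)
  ultimately show ?thesis
    unfolding tendsto_dist_iff[of _ "\<phi> T"] by (rule tendsto_0_le)
qed

lemma op_state_unique:
  assumes \<phi>: "op_state infinite_tensor_algebra \<phi>" and \<phi>': "op_state infinite_tensor_algebra \<phi>'"
    and loc: "\<And>n a. \<phi>' (local_op n a) = \<phi> (local_op n a)" and T: "T \<in> infinite_tensor_algebra"
  shows "\<phi>' T = \<phi> T"
proof -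
  obtain p a where S: "(\<lambda>n. local_op (p n) (a n)) \<longlonglongrightarrow> T"
    by (rule algebraE[OF T])
  show ?thesis
    using op_state_tendsto[OF \<phi>' local_op_in_algebra S] op_state_tendsto[OF \<phi> local_op_in_algebra S]
    unfolding loc by (rule LIMSEQ_unique)
qed

text \<open>On a local operator the sequence is eventually constant. The Lipschitz bound, uniform in
  \<open>n\<close>, makes it Cauchy on the norm closure, and each property of a state passes to
  pointwise limits. Off the algebra \<open>lim\<close> may be arbitrary, which
  \<open>op_state\<close> permits.\<close>

lemma op_state_sequence_limit:
  fixes \<phi> :: "nat \<Rightarrow> (nat \<Rightarrow> 's::finite) ell2 \<Rightarrow>\<^sub>L (nat \<Rightarrow> 's) ell2 \<Rightarrow> complex"
  assumes \<phi>: "\<And>n. op_state infinite_tensor_algebra (\<phi> n)"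
    and loc: "\<And>p a n. p \<le> n \<Longrightarrow> \<phi> n (local_op p a) = \<phi> p (local_op p a)"
  shows "op_state infinite_tensor_algebra (\<lambda>T. lim (\<lambda>n. \<phi> n T))"
proof -
  have "Cauchy (\<lambda>n. \<phi> n T)" if T: "T \<in> infinite_tensor_algebra" for T
  proof (rule metric_CauchyI)
    fix e :: real assume "e > 0"
    \<comment> \<open>The Lipschitz constant 2 turns \<open>e / 4\<close> into \<open>e / 2\<close>,
      and two such distances to \<open>\<phi> p S\<close> add up to \<open>e\<close>.\<close>
    then have "e / 4 > 0" by simp
    then have "\<exists>S\<in>(\<Union>n. range (local_op n)). dist S T < e / 4"
      using T unfolding infinite_tensor_algebra_def closure_approachable by blast
    then obtain S p a where S: "dist S T < e / 4" and p: "S = local_op p a"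
      by auto
    have near: "dist (\<phi> n T) (\<phi> p S) < e / 2" if "n \<ge> p" for n
      using op_state_dist_le[OF \<phi>[of n] T, of S] S loc[OF that, of a]
      by (simp add: p local_op_in_algebra dist_commute)
    then show "\<exists>N. \<forall>m\<ge>N. \<forall>n\<ge>N. dist (\<phi> m T) (\<phi> n T) < e"
      by (meson dist_triangle_half_l)
  qed
  then have lim: "(\<lambda>n. \<phi> n T) \<longlonglongrightarrow> lim (\<lambda>n. \<phi> n T)" if "T \<in> infinite_tensor_algebra" for T
    using that Cauchy_convergent convergent_LIMSEQ_iff by blast
  show ?thesis
    unfolding op_state_def
  proof (intro conjI ballI allI impI)
    fix S T :: "(nat \<Rightarrow> 's) ell2 \<Rightarrow>\<^sub>L (nat \<Rightarrow> 's) ell2"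
    assume S: "S \<in> infinite_tensor_algebra" and T: "T \<in> infinite_tensor_algebra"
    show "lim (\<lambda>n. \<phi> n (S + T)) = lim (\<lambda>n. \<phi> n S) + lim (\<lambda>n. \<phi> n T)"
      by (rule limI) (simp add: op_state_add[OF \<phi> S T] tendsto_add lim S T)
  next
    fix T :: "(nat \<Rightarrow> 's) ell2 \<Rightarrow>\<^sub>L (nat \<Rightarrow> 's) ell2" and c
    assume T: "T \<in> infinite_tensor_algebra"
    show "lim (\<lambda>n. \<phi> n (op_scaleC c T)) = c * lim (\<lambda>n. \<phi> n T)"
      by (rule limI) (simp add: op_state_scaleC[OF \<phi> T] tendsto_mult_left lim T)
    show "lim (\<lambda>n. \<phi> n T) \<in> \<real>\<^sub>\<ge>\<^sub>0" if "positive_op T"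
      by (rule closed_sequentially[OF closed_nonneg_Reals_complex _ lim[OF T]])
        (rule op_state_nonneg[OF \<phi> T that])
  next
    show "lim (\<lambda>n. \<phi> n id_blinfun) = 1"
      by (rule limI) (simp add: op_state_id[OF \<phi>])
  qed
qed

section \<open>Path amplitudes of the hidden Markov model\<close>

lemma sum_pair_fst:
  fixes f :: "'a::finite \<times> 'b::finite \<Rightarrow> 'c::comm_monoid_add"
  shows "(\<Sum>p\<in>UNIV. if fst p = i then f p else 0) = (\<Sum>k\<in>UNIV. f (i, k))"
proof -
  have "(\<Sum>p\<in>UNIV. if fst p = i then f p else 0) =
      (\<Sum>a\<in>UNIV. \<Sum>k\<in>UNIV. if a = i then f (a, k) else 0)"
    by (auto simp: sum.cartesian_product case_prod_beta intro!: sum.cong)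
  also have "\<dots> = (\<Sum>k\<in>UNIV. \<Sum>a\<in>UNIV. if a = i then f (a, k) else 0)"
    by (rule sum.swap)
  finally show ?thesis by simp
qed

text \<open>The common shape of the transition and emission maps: the input index is copied into the
  first factor while the second receives the amplitudes \<open>v\<close>. Each fact about it serves
  both maps.\<close>

definition fork_matrix :: "('a::finite \<Rightarrow> 'b::finite \<Rightarrow> complex) \<Rightarrow> complex ^ 'a ^ ('a \<times> 'b)" where
  "fork_matrix v = (\<chi> p i. if fst p = i then v i (snd p) else 0)"

lemma eq_fork_matrix:
  fixes V :: "complex ^ 'a::finite ^ ('a \<times> 'b::finite)"
  assumes "\<And>i. V *v axis i 1 = (\<Sum>k\<in>UNIV. v i k *s vtensor (axis i 1) (axis k 1))"
  shows "V = fork_matrix v"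
proof -
  have "V $ p $ i = (if fst p = i then v i (snd p) else 0)" for p i
  proof -
    have "V $ p $ i = (V *v axis i 1) $ p"
      by (simp add: matrix_vector_mult_def axis_def if_distrib[of "\<lambda>c. _ * c"] cong: if_cong)
    also have "\<dots> = (\<Sum>k\<in>UNIV. if k = snd p then (if fst p = i then v i k else 0) else 0)"
      unfolding assms sum_component by (rule sum.cong) (auto simp: vtensor_def axis_def)
    also have "\<dots> = (if fst p = i then v i (snd p) else 0)"
      by simp
    finally show ?thesis .
  qed
  then show ?thesis by (simp add: fork_matrix_def vec_eq_iff)
qed

lemma norm_vec_power2: "(norm (x :: complex ^ 'a::finite))\<^sup>2 = (\<Sum>i\<in>UNIV. (cmod (x $ i))\<^sup>2)"
  by (simp add: norm_vec_def L2_set_def sum_nonneg)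

text \<open>Row \<open>p\<close> has its only possibly non-zero entry in column
  \<open>fst p\<close>, so summing squares over the second index contributes the factor 1 for each
  coordinate of \<open>x\<close>. This is an isometry on the whole space, hence a partial
  isometry.\<close>

lemma fork_matrix_isometry:
  fixes v :: "'a::finite \<Rightarrow> 'b::finite \<Rightarrow> complex"
  assumes "\<And>i. (\<Sum>k\<in>UNIV. (cmod (v i k))\<^sup>2) = 1"
  shows "norm (fork_matrix v *v x) = norm x"
proof -
  have "(fork_matrix v *v x) $ p = v (fst p) (snd p) * x $ fst p" for p
    by (simp add: fork_matrix_def matrix_vector_mult_def if_distrib[of "\<lambda>c. c * _"] cong: if_cong)
  then have "(norm (fork_matrix v *v x))\<^sup>2 = (\<Sum>a\<in>UNIV. \<Sum>k\<in>UNIV. (cmod (v a k))\<^sup>2 * (cmod (x $ a))\<^sup>2)"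
    by (simp add: norm_vec_power2 norm_mult power_mult_distrib sum.cartesian_product
        case_prod_beta flip: UNIV_Times_UNIV)
  also have "\<dots> = (norm x)\<^sup>2"
    by (simp add: assms norm_vec_power2 flip: sum_distrib_right)
  finally show ?thesis by simp
qed

lemma transition_expectation_fork_matrix:
  fixes v :: "'a::finite \<Rightarrow> 'b::finite \<Rightarrow> complex"
  shows "transition_expectation (fork_matrix v) M $ i $ j =
    (\<Sum>k\<in>UNIV. \<Sum>k'\<in>UNIV. cnj (v i k) * M $ (i, k) $ (j, k') * v j k')"
proof -
  have "transition_expectation (fork_matrix v) M $ i $ j =
      (\<Sum>q\<in>UNIV. if fst q = j then
        (\<Sum>p\<in>UNIV. if fst p = i then cnj (v i (snd p)) * M $ p $ q else 0) * v j (snd q) else 0)"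
    unfolding transition_expectation_def matrix_matrix_mult_def dagger_def fork_matrix_def
    by (auto intro!: sum.cong arg_cong2[where f = "(*)"])
  also have "\<dots> = (\<Sum>k'\<in>UNIV. \<Sum>k\<in>UNIV. cnj (v i k) * M $ (i, k) $ (j, k') * v j k')"
    unfolding sum_pair_fst by (simp add: sum_distrib_right)
  finally show ?thesis
    by (subst sum.swap)
qed

text \<open>Because the input index is copied, the off-diagonal entries vanish; the diagonal ones
  are the row sums. This is what makes the values consistent when sites are added.\<close>

lemma transition_expectation_fork_matrix_one:
  fixes v :: "'a::finite \<Rightarrow> 'b::finite \<Rightarrow> complex"
  assumes "\<And>i. (\<Sum>k\<in>UNIV. (cmod (v i k))\<^sup>2) = 1"
  shows "transition_expectation (fork_matrix v) (mat 1) = mat 1"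
proof -
  have "(\<Sum>k\<in>UNIV. cnj (v i k) * v i k) = of_real (\<Sum>k\<in>UNIV. (cmod (v i k))\<^sup>2)" for i
    by (simp add: complex_norm_square mult.commute del: of_real_power)
  then have one: "(\<Sum>k\<in>UNIV. cnj (v i k) * v i k) = 1" for i
    by (simp add: assms)
  have "transition_expectation (fork_matrix v) (mat 1) $ i $ j = mat 1 $ i $ j" for i j
  proof -
    have "transition_expectation (fork_matrix v) (mat 1) $ i $ j =
        (\<Sum>k\<in>UNIV. \<Sum>k'\<in>UNIV. if k' = k then (if i = j then cnj (v i k) * v j k else 0) else 0)"
      unfolding transition_expectation_fork_matrix
      by (intro sum.cong refl) (auto simp: mat_def)
    also have "\<dots> = (\<Sum>k\<in>UNIV. if i = j then cnj (v i k) * v j k else 0)"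
      by simp
    also have "\<dots> = mat 1 $ i $ j"
      by (cases "i = j") (simp_all add: one mat_def)
    finally show ?thesis .
  qed
  then show ?thesis by (simp add: vec_eq_iff)
qed

lemma mtensor_one: "mtensor (mat 1) (mat 1) = mat 1"
  by (auto simp: mtensor_def mat_def vec_eq_iff prod_eq_iff)

text \<open>The matrix entry, from \<open>i\<close> to the output \<open>\<xi>\<close> and the final
  hidden state \<open>b\<close>, of the composed isometry of the \<open>r\<close> sites from
  \<open>l\<close> on. Coordinate \<open>t\<close> of \<open>\<xi>\<close> belongs to site
  \<open>l + t\<close>. At most one \<open>j\<close> contributes: the hidden component of the next
  coordinate, or \<open>b\<close> at the end.\<close>

fun path_amplitude ::
  "(nat \<Rightarrow> 'm::finite \<Rightarrow> 'm \<Rightarrow> complex) \<Rightarrow> (nat \<Rightarrow> 'm \<Rightarrow> 'd \<Rightarrow> complex) \<Rightarrow> nat \<Rightarrow> nat \<Rightarrow>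
    'm \<Rightarrow> (nat \<Rightarrow> 'm \<times> 'd) \<Rightarrow> 'm \<Rightarrow> complex"
where
  "path_amplitude u w l 0 i \<xi> b = (if i = b then 1 else 0)"
| "path_amplitude u w l (Suc r) i \<xi> b =
    (if fst (\<xi> 0) = i then w l i (snd (\<xi> 0)) *
      (\<Sum>j\<in>UNIV. u l i j * path_amplitude u w (Suc l) r j (\<lambda>t. \<xi> (Suc t)) b) else 0)"

lemma sum_bilinear:
  fixes c d :: "_ \<Rightarrow> 'a::comm_ring_1"
  shows "(\<Sum>a\<in>A. \<Sum>b\<in>B. c a * (\<Sum>s\<in>S. f a s * p s * g b s) * d b) =
    (\<Sum>s\<in>S. (\<Sum>a\<in>A. c a * f a s) * p s * (\<Sum>b\<in>B. d b * g b s))"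
proof -
  let ?t = "\<lambda>a b s. c a * f a s * p s * (d b * g b s)"
  have "(\<Sum>a\<in>A. \<Sum>b\<in>B. c a * (\<Sum>s\<in>S. f a s * p s * g b s) * d b) =
      (\<Sum>a\<in>A. \<Sum>b\<in>B. \<Sum>s\<in>S. ?t a b s)"
    by (simp add: sum_distrib_left sum_distrib_right mult_ac)
  also have "\<dots> = (\<Sum>a\<in>A. \<Sum>s\<in>S. \<Sum>b\<in>B. ?t a b s)"
    by (intro sum.cong refl sum.swap)
  also have "\<dots> = (\<Sum>s\<in>S. \<Sum>a\<in>A. \<Sum>b\<in>B. ?t a b s)"
    by (rule sum.swap)
  finally show ?thesis
    by (simp only: sum_distrib_right[where r = "p s" for s] sum_product)
qed

text \<open>Absorbs the outer coefficients into the left and right factors. In its use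
  \<open>x\<close> and \<open>y\<close> are the left and right configurations, and \<open>z\<close>
  is the final hidden state shared by both sides.\<close>

lemma sum_bilinear3:
  fixes c d :: "_ \<Rightarrow> 'a::comm_ring_1"
  shows "(\<Sum>a\<in>A. \<Sum>b\<in>B. c a * (\<Sum>x\<in>X. \<Sum>y\<in>Y. \<Sum>z\<in>Z. f a x z * p x y * g b y z) * d b) =
    (\<Sum>x\<in>X. \<Sum>y\<in>Y. \<Sum>z\<in>Z. (\<Sum>a\<in>A. c a * f a x z) * p x y * (\<Sum>b\<in>B. d b * g b y z))"
  using sum_bilinear[where S = "X \<times> Y \<times> Z" and f = "\<lambda>a s. f a (fst s) (snd (snd s))"
      and g = "\<lambda>b s. g b (fst (snd s)) (snd (snd s))" and p = "\<lambda>s. p (fst s) (fst (snd s))"]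
  by (simp add: sum.cartesian_product case_prod_beta)

text \<open>Induction on the number of sites, removing the first one. Copying of indices makes the
  first site an emission factor times a transition sum, and the latter prolongs the amplitudes of
  the remaining sites.\<close>

lemma ehmm_Z_path_sum:
  fixes u :: "nat \<Rightarrow> 'm::finite \<Rightarrow> 'm \<Rightarrow> complex" and w :: "nat \<Rightarrow> 'm \<Rightarrow> 'd::finite \<Rightarrow> complex"
  shows "ehmm_Z (\<lambda>n. fork_matrix (u n)) (\<lambda>n. fork_matrix (w n)) X Y l r $ i $ j =
    (\<Sum>\<xi>\<in>configs r. \<Sum>\<eta>\<in>configs r. \<Sum>b\<in>UNIV. cnj (path_amplitude u w l r i \<xi> b) *
      (\<Prod>t<r. mtensor (X (l + t)) (Y (l + t)) $ \<xi> t $ \<eta> t) * path_amplitude u w l r j \<eta> b)"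
proof (induction r arbitrary: l i j)
  case 0
  have "(\<Sum>b\<in>UNIV. cnj (if i = b then 1 else 0) * (if j = b then 1 else 0)) =
      (\<Sum>b\<in>UNIV. if b = i then mat 1 $ i $ j else (0::complex))"
    by (rule sum.cong) (auto simp: mat_def)
  then show ?case by simp
next
  case (Suc r)
  let ?amp = "path_amplitude u w (Suc l) r"
  let ?P = "\<lambda>\<xi> \<eta>. \<Prod>t<r. mtensor (X (Suc l + t)) (Y (Suc l + t)) $ \<xi> t $ \<eta> t"
  let ?E = "mtensor (X l) (Y l)"
  \<comment> \<open>The amplitude of the later sites after one transition out of \<open>i\<close>;
    it does not depend on the symbol emitted at site \<open>l\<close>.\<close>
  define S where "S = (\<lambda>i \<xi> b. \<Sum>a\<in>UNIV. u l i a * ?amp a \<xi> b)"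
  have amp_Suc: "path_amplitude u w l (Suc r) i (case_nat c \<xi>) b =
      (if fst c = i then w l i (snd c) * S i \<xi> b else 0)" for i c \<xi> b
    by (simp add: S_def)
  define G where "G = (\<Sum>\<xi>\<in>configs r. \<Sum>\<eta>\<in>configs r. \<Sum>b\<in>UNIV.
    cnj (S i \<xi> b) * ?P \<xi> \<eta> * S j \<eta> b)"
  let ?Z = "ehmm_Z (\<lambda>n. fork_matrix (u n)) (\<lambda>n. fork_matrix (w n)) X Y"
  let ?T = "transition_expectation (fork_matrix (w l)) ?E $ i $ j"
  \<comment> \<open>Both hidden indices \<open>i\<close> and \<open>j\<close> are copied, so the
    emission entry is constant in the transition sum and factors out.\<close>
  have "?Z l (Suc r) $ i $ j =
      ?T * (\<Sum>a\<in>UNIV. \<Sum>a'\<in>UNIV. cnj (u l i a) * ?Z (Suc l) r $ a $ a' * u l j a')"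
    by (simp add: transition_expectation_fork_matrix[of "u l"] mtensor_def sum_distrib_left mult_ac)
  also have "\<dots> = ?T * G"
    unfolding Suc.IH G_def S_def cnj_sum complex_cnj_mult sum_bilinear3 ..
  also have "\<dots> = (\<Sum>k\<in>UNIV. \<Sum>k'\<in>UNIV.
      cnj (w l i k) * ?E $ (i, k) $ (j, k') * w l j k' * G)"
    by (simp add: transition_expectation_fork_matrix sum_distrib_right)
  \<comment> \<open>\<open>sum_pair_fst\<close> read backwards: the pinned hidden components become
    conditions on full site symbols, exactly those in \<open>path_amplitude\<close>.\<close>
  also have "\<dots> = (\<Sum>c\<in>UNIV. if fst c = i then \<Sum>c'\<in>UNIV. if fst c' = j then
      cnj (w l i (snd c)) * ?E $ c $ c' * w l j (snd c') * G else 0 else 0)"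
    unfolding sum_pair_fst by simp
  also have "\<dots> = (\<Sum>c\<in>UNIV. \<Sum>c'\<in>UNIV. \<Sum>\<xi>\<in>configs r. \<Sum>\<eta>\<in>configs r. \<Sum>b\<in>UNIV.
      cnj (path_amplitude u w l (Suc r) i (case_nat c \<xi>) b) * (?E $ c $ c' * ?P \<xi> \<eta>) *
      path_amplitude u w l (Suc r) j (case_nat c' \<eta>) b)"
    by (intro sum.cong refl)
      (auto simp: amp_Suc G_def sum_distrib_left mult_ac simp del: path_amplitude.simps
        intro!: sum.cong)
  \<comment> \<open>Each first symbol is placed next to its own tail, as
    \<open>sum_configs_Suc_shift\<close> requires.\<close>
  also have "\<dots> = (\<Sum>c\<in>UNIV. \<Sum>\<xi>\<in>configs r. \<Sum>c'\<in>UNIV. \<Sum>\<eta>\<in>configs r. \<Sum>b\<in>UNIV.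
      cnj (path_amplitude u w l (Suc r) i (case_nat c \<xi>) b) * (?E $ c $ c' * ?P \<xi> \<eta>) *
      path_amplitude u w l (Suc r) j (case_nat c' \<eta>) b)"
    by (intro sum.cong refl sum.swap)
  finally show ?case
    unfolding sum_configs_Suc_shift prod.lessThan_Suc_shift by simp
qed

text \<open>Where all later observables are identities, the backward recursion stays at the
  identity, since both expectations preserve it.\<close>

lemma ehmm_Z_extend:
  assumes "\<And>n. transition_expectation (VH n) (mat 1) = mat 1"
    and "\<And>n. transition_expectation (VHO n) (mat 1) = mat 1"
    and "\<And>t. l + r \<le> t \<Longrightarrow> X t = mat 1" "\<And>t. l + r \<le> t \<Longrightarrow> Y t = mat 1"
  shows "ehmm_Z VH VHO X Y l (r + s) = ehmm_Z VH VHO X Y l r"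
  using assms(3,4)
proof (induction r arbitrary: l)
  case 0
  then show ?case
    by (induction s arbitrary: l) (simp_all add: mtensor_one assms(1,2))
qed simp

lemma ehmm_Z_cong:
  assumes "\<And>t. l \<le> t \<Longrightarrow> t < l + r \<Longrightarrow> X t = X' t" "\<And>t. l \<le> t \<Longrightarrow> t < l + r \<Longrightarrow> Y t = Y' t"
  shows "ehmm_Z VH VHO X Y l r = ehmm_Z VH VHO X' Y' l r"
  using assms
proof (induction r arbitrary: l)
  case (Suc r)
  have "ehmm_Z VH VHO X Y (Suc l) r = ehmm_Z VH VHO X' Y' (Suc l) r"
    by (rule Suc.IH) (simp_all add: Suc.prems)
  then show ?case by (simp add: Suc.prems)
qed simp

section \<open>Compressions of the algebra by path vectors\<close>

text \<open>
  Elements of \<open>configs n\<close> are sequences with the value \<open>undefined\<close> at all sites from \<open>n\<close> on,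
  so that they are themselves basis elements of the Hilbert space of the algebra.
\<close>

lift_definition config_vec :: "nat \<Rightarrow> ((nat \<Rightarrow> 's::finite) \<Rightarrow> complex) \<Rightarrow> (nat \<Rightarrow> 's) ell2"
  is "\<lambda>n f \<omega>. if \<omega> \<in> configs n then f \<omega> else 0"
proof -
  fix n and f :: "(nat \<Rightarrow> 's) \<Rightarrow> complex"
  have "(\<lambda>\<omega>. (cmod (f \<omega>))\<^sup>2) summable_on configs n"
    by (simp add: finite_configs)
  then show "(\<lambda>\<omega>. (cmod (if \<omega> \<in> configs n then f \<omega> else 0))\<^sup>2) summable_on UNIV"
    by (rule summable_on_cong_neutral[THEN iffD1, rotated -1]) auto
qed

text \<open>The vectors live on sequences that are \<open>undefined\<close> from \<open>n\<close>
  on; overwriting the first \<open>n\<close> coordinates of such a sequence by those of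
  \<open>\<eta>\<close> gives \<open>\<eta>\<close> itself. The infinite sum thus reduces to the
  finite sesquilinear form of \<open>a\<close>.\<close>

lemma cinner_local_op_config_vec:
  fixes f g :: "(nat \<Rightarrow> 's::finite) \<Rightarrow> complex"
  shows "cinner (config_vec n f) (local_op n a (config_vec n g)) =
    (\<Sum>\<xi>\<in>configs n. \<Sum>\<eta>\<in>configs n. cnj (f \<xi>) * a \<xi> \<eta> * g \<eta>)"
proof -
  have r: "restrict \<xi> {..<n} = \<xi>" if "\<xi> \<in> configs n" for \<xi> :: "nat \<Rightarrow> 's"
    using that by (auto simp: fun_eq_iff PiE_def extensional_def)
  have s: "(\<lambda>l. if l < n then \<eta> l else \<xi> l) = \<eta>" if "\<xi> \<in> configs n" "\<eta> \<in> configs n"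
    for \<xi> \<eta> :: "nat \<Rightarrow> 's"
    using that by (auto simp: fun_eq_iff PiE_def extensional_def)
  have "cinner (config_vec n f) (local_op n a (config_vec n g)) =
      (\<Sum>\<^sub>\<infinity>\<xi>\<in>configs n. cnj (f \<xi>) * ell2_fun (local_op n a (config_vec n g)) \<xi>)"
    unfolding cinner.rep_eq by (rule infsum_cong_neutral) (auto simp: config_vec.rep_eq)
  also have "\<dots> = (\<Sum>\<xi>\<in>configs n. cnj (f \<xi>) * ell2_fun (local_op n a (config_vec n g)) \<xi>)"
    by (simp add: finite_configs)
  also have "\<dots> = (\<Sum>\<xi>\<in>configs n. \<Sum>\<eta>\<in>configs n. cnj (f \<xi>) * a \<xi> \<eta> * g \<eta>)"
    unfolding local_op_apply sum_distrib_left
    by (intro sum.cong refl) (simp add: r s config_vec.rep_eq del: restrict_apply)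
  finally show ?thesis .
qed

text \<open>The matrix of V^* (T tensor 1) V, where V sends the basis vector \<open>j\<close> to the
  sum over \<open>b\<close> of \<open>\<Psi> j b\<close> tensored with the basis vector
  \<open>b\<close>. In the application \<open>b\<close> is the hidden state left after the last
  site.\<close>

definition compression ::
    "('i::finite \<Rightarrow> 'b::finite \<Rightarrow> 'a ell2) \<Rightarrow> ('a ell2 \<Rightarrow>\<^sub>L 'a ell2) \<Rightarrow> complex ^ 'i ^ 'i" where
  "compression \<Psi> T = (\<chi> i j. \<Sum>b\<in>UNIV. cinner (\<Psi> i b) (T (\<Psi> j b)))"

lemma nonneg_Reals_sum: "(\<And>i. i \<in> F \<Longrightarrow> f i \<in> \<real>\<^sub>\<ge>\<^sub>0) \<Longrightarrow> sum f F \<in> (\<real>\<^sub>\<ge>\<^sub>0 :: complex set)"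
  by (induction F rule: infinite_finite_induct) (simp_all add: nonneg_Reals_add_I)

text \<open>The quadratic form of the compression at \<open>x\<close> is the sum over
  \<open>b\<close> of the quadratic form of \<open>T\<close> at the combinations
  \<open>?v b\<close>; complex linearity of \<open>T\<close> takes out the coefficients.\<close>

lemma positive_compression:
  fixes \<Psi> :: "'i::finite \<Rightarrow> 'b::finite \<Rightarrow> (nat \<Rightarrow> 's::finite) ell2"
  assumes T: "T \<in> infinite_tensor_algebra" "positive_op T"
  shows "positive_matrix (compression \<Psi> T)"
  unfolding positive_matrix_def
proof
  fix x :: "complex ^ 'i"
  let ?v = "\<lambda>b. \<Sum>i\<in>UNIV. scaleC_ell2 (x $ i) (\<Psi> i b)"
  let ?t = "\<lambda>b j i. x $ j * (cnj (x $ i) * cinner (\<Psi> i b) (T (\<Psi> j b)))"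
  have "hinner x (compression \<Psi> T *v x) = (\<Sum>i\<in>UNIV. \<Sum>j\<in>UNIV. \<Sum>b\<in>UNIV. ?t b j i)"
    by (simp add: hinner_def compression_def matrix_vector_mult_def sum_distrib_left
        sum_distrib_right mult_ac)
  also have "\<dots> = (\<Sum>j\<in>UNIV. \<Sum>i\<in>UNIV. \<Sum>b\<in>UNIV. ?t b j i)"
    by (rule sum.swap)
  also have "\<dots> = (\<Sum>j\<in>UNIV. \<Sum>b\<in>UNIV. \<Sum>i\<in>UNIV. ?t b j i)"
    by (intro sum.cong refl sum.swap)
  also have "\<dots> = (\<Sum>b\<in>UNIV. \<Sum>j\<in>UNIV. \<Sum>i\<in>UNIV. ?t b j i)"
    by (rule sum.swap)
  also have "\<dots> = (\<Sum>b\<in>UNIV. cinner (?v b) (T (?v b)))"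
    by (simp add: blinfun.sum_right algebra_complex_linear[OF T(1)] cinner_sum_left cinner_sum_right
        cinner_scaleC_left cinner_scaleC_right sum_distrib_left)
  also have "\<dots> \<in> \<real>\<^sub>\<ge>\<^sub>0"
    using T(2) unfolding positive_op_def by (intro nonneg_Reals_sum) blast
  finally show "hinner x (compression \<Psi> T *v x) \<in> \<real>\<^sub>\<ge>\<^sub>0" .
qed

lemma op_state_compression:
  fixes \<Psi> :: "'i::finite \<Rightarrow> 'b::finite \<Rightarrow> (nat \<Rightarrow> 's::finite) ell2"
  assumes \<phi>: "matrix_state \<phi>" and one: "compression \<Psi> id_blinfun = mat 1"
  shows "op_state infinite_tensor_algebra (\<lambda>T. \<phi> (compression \<Psi> T))"
proof -
  have "compression \<Psi> (S + T) = compression \<Psi> S + compression \<Psi> T" for S T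
    by (simp add: compression_def vec_eq_iff plus_blinfun.rep_eq cinner_add_right sum.distrib)
  moreover have "compression \<Psi> (op_scaleC c T) = mscale c (compression \<Psi> T)" for c T
    by (simp add: compression_def mscale_def vec_eq_iff op_scaleC_apply cinner_scaleC_right
        sum_distrib_left)
  ultimately show ?thesis
    using \<phi> one positive_compression[of _ \<Psi>] by (simp add: op_state_def matrix_state_def)
qed

text \<open>Membership is proved along with the value, because a state is additive only on the
  algebra.\<close>

lemma op_state_sum:
  assumes \<phi>: "op_state infinite_tensor_algebra \<phi>"
    and "finite F" "\<And>i. i \<in> F \<Longrightarrow> f i \<in> infinite_tensor_algebra"
  shows "sum f F \<in> infinite_tensor_algebra \<and> \<phi> (sum f F) = (\<Sum>i\<in>F. \<phi> (f i))"
  using assms(2,3)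
proof (induction F rule: finite_induct)
  case empty
  show ?case
    using op_state_scaleC[OF \<phi> id_in_algebra, of 0] algebra_scaleC[OF id_in_algebra, of 0]
    by (simp add: op_scaleC_0)
next
  case (insert i F)
  then show ?case by (simp add: algebra_add op_state_add[OF \<phi>])
qed

lemma op_state_local_op_eqI:
  fixes \<phi> \<phi>' :: "(nat \<Rightarrow> 'm::finite \<times> 'd::finite) ell2 \<Rightarrow>\<^sub>L (nat \<Rightarrow> 'm \<times> 'd) ell2 \<Rightarrow> complex"
  assumes \<phi>: "op_state infinite_tensor_algebra \<phi>" and \<phi>': "op_state infinite_tensor_algebra \<phi>'"
    and eq: "\<And>X Y. \<phi> (elementary_tensor n (\<lambda>l. mtensor (X l) (Y l))) =
      \<phi>' (elementary_tensor n (\<lambda>l. mtensor (X l) (Y l)))"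
  shows "\<phi> (local_op n a) = \<phi>' (local_op n a)"
proof -
  have unit: "matrix_unit n \<xi> \<eta> \<in> infinite_tensor_algebra \<and>
      \<phi> (matrix_unit n \<xi> \<eta>) = \<phi>' (matrix_unit n \<xi> \<eta>)"
    if "\<xi> \<in> configs n" "\<eta> \<in> configs n" for \<xi> \<eta>
  proof -
    \<comment> \<open>A one-site matrix unit over pairs splits into a hidden and an observed matrix
      unit, so it has the product form to which the hypothesis applies.\<close>
    have "(\<chi> s t. if s = \<xi> l \<and> t = \<eta> l then 1 else 0) =
        mtensor (\<chi> i j. if i = fst (\<xi> l) \<and> j = fst (\<eta> l) then 1 else 0)
          (\<chi> i j. if i = snd (\<xi> l) \<and> j = snd (\<eta> l) then 1 else 0)" for l
      by (auto simp: mtensor_def vec_eq_iff prod_eq_iff)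
    then show ?thesis
      using eq by (simp add: matrix_unit_eq_elementary_tensor[OF that] elementary_tensor_in_algebra)
  qed
  have row: "(\<Sum>\<eta>\<in>configs n. op_scaleC (a \<xi> \<eta>) (matrix_unit n \<xi> \<eta>)) \<in> infinite_tensor_algebra \<and>
      \<psi> (\<Sum>\<eta>\<in>configs n. op_scaleC (a \<xi> \<eta>) (matrix_unit n \<xi> \<eta>)) =
        (\<Sum>\<eta>\<in>configs n. a \<xi> \<eta> * \<psi> (matrix_unit n \<xi> \<eta>))"
    if \<psi>: "op_state infinite_tensor_algebra \<psi>" and \<xi>: "\<xi> \<in> configs n" for \<psi> \<xi>
    using op_state_sum[OF \<psi> finite_configs, of n "\<lambda>\<eta>. op_scaleC (a \<xi> \<eta>) (matrix_unit n \<xi> \<eta>)"]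
      op_state_scaleC[OF \<psi>] unit[OF \<xi>] by (simp add: algebra_scaleC)
  have eval: "\<psi> (local_op n a) = (\<Sum>\<xi>\<in>configs n. \<Sum>\<eta>\<in>configs n. a \<xi> \<eta> * \<psi> (matrix_unit n \<xi> \<eta>))"
    if \<psi>: "op_state infinite_tensor_algebra \<psi>" for \<psi>
  proof -
    let ?row = "\<lambda>\<xi>. \<Sum>\<eta>\<in>configs n. op_scaleC (a \<xi> \<eta>) (matrix_unit n \<xi> \<eta>)"
    have "\<psi> (sum ?row (configs n)) = (\<Sum>\<xi>\<in>configs n. \<psi> (?row \<xi>))"
      by (rule op_state_sum[OF \<psi> finite_configs, THEN conjunct2]) (simp add: row[OF \<psi>])
    then show ?thesis
      unfolding local_op_def by (simp add: row[OF \<psi>])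
  qed
  then show ?thesis
    by (simp add: eval[OF \<phi>] eval[OF \<phi>'] unit)
qed

lemma compression_path_vectors:
  fixes u :: "nat \<Rightarrow> 'm::finite \<Rightarrow> 'm \<Rightarrow> complex" and w :: "nat \<Rightarrow> 'm \<Rightarrow> 'd::finite \<Rightarrow> complex"
  shows "compression (\<lambda>i b. config_vec n (\<lambda>\<xi>. path_amplitude u w 0 n i \<xi> b))
      (elementary_tensor n (\<lambda>l. mtensor (X l) (Y l))) =
    ehmm_Z (\<lambda>n. fork_matrix (u n)) (\<lambda>n. fork_matrix (w n)) X Y 0 n" (is "?L = ?R")
proof -
  have "?L $ i $ j = ?R $ i $ j" for i j
  proof -
    let ?t = "\<lambda>b \<xi> \<eta>. cnj (path_amplitude u w 0 n i \<xi> b) *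
      (\<Prod>t<n. mtensor (X t) (Y t) $ \<xi> t $ \<eta> t) * path_amplitude u w 0 n j \<eta> b"
    have "?L $ i $ j = (\<Sum>b\<in>UNIV. \<Sum>\<xi>\<in>configs n. \<Sum>\<eta>\<in>configs n. ?t b \<xi> \<eta>)"
      by (simp add: compression_def elementary_tensor_def cinner_local_op_config_vec)
    also have "\<dots> = (\<Sum>\<xi>\<in>configs n. \<Sum>b\<in>UNIV. \<Sum>\<eta>\<in>configs n. ?t b \<xi> \<eta>)"
      by (rule sum.swap)
    also have "\<dots> = (\<Sum>\<xi>\<in>configs n. \<Sum>\<eta>\<in>configs n. \<Sum>b\<in>UNIV. ?t b \<xi> \<eta>)"
      by (intro sum.cong refl sum.swap)
    finally show ?thesis
      by (simp add: ehmm_Z_path_sum)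
  qed
  then show ?thesis by (simp add: vec_eq_iff)
qed

section \<open>Uniqueness and existence of the state of the model\<close>

lemma is_ehmm_state_unique:
  fixes \<phi> \<phi>' :: "(nat \<Rightarrow> 'm::finite \<times> 'd::finite) ell2 \<Rightarrow>\<^sub>L (nat \<Rightarrow> 'm \<times> 'd) ell2 \<Rightarrow> complex"
  assumes \<phi>: "is_ehmm_state VH VHO \<phi>\<^sub>1 \<phi>" and \<phi>': "is_ehmm_state VH VHO \<phi>\<^sub>1 \<phi>'"
    and T: "T \<in> infinite_tensor_algebra"
  shows "\<phi>' T = \<phi> T"
proof (rule op_state_unique[OF _ _ _ T])
  show st: "op_state infinite_tensor_algebra \<phi>" "op_state infinite_tensor_algebra \<phi>'"
    using \<phi> \<phi>' by (simp_all add: is_ehmm_state_def)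
  fix n and a :: "(nat \<Rightarrow> 'm \<times> 'd) \<Rightarrow> (nat \<Rightarrow> 'm \<times> 'd) \<Rightarrow> complex"
  \<comment> \<open>One more site is used because the defining equation is available only for at
    least one site, while \<open>n\<close> may be 0.\<close>
  have "local_op n a \<in> range (local_op (Suc n))"
    by (rule subsetD[OF local_op_mono[of n]]) auto
  then obtain a' where "local_op n a = local_op (Suc n) a'"
    by (elim rangeE)
  moreover have "\<phi>' (local_op (Suc n) a') = \<phi> (local_op (Suc n) a')"
  proof (rule op_state_local_op_eqI[OF st(2,1)])
    have "\<psi> (elementary_tensor (Suc n) (\<lambda>l. mtensor (X l) (Y l))) = \<phi>\<^sub>1 (ehmm_Z VH VHO X Y 0 (Suc n))"
      if "is_ehmm_state VH VHO \<phi>\<^sub>1 \<psi>" for \<psi> X Y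
      using that unfolding is_ehmm_state_def by (elim conjE allE[of _ "Suc n"]) simp
    then show "\<phi>' (elementary_tensor (Suc n) (\<lambda>l. mtensor (X l) (Y l))) =
        \<phi> (elementary_tensor (Suc n) (\<lambda>l. mtensor (X l) (Y l)))" for X Y
      using \<phi> \<phi>' by metis
  qed
  ultimately show "\<phi>' (local_op n a) = \<phi> (local_op n a)"
    by simp
qed

lemma is_ehmm_state_exists:
  fixes u :: "nat \<Rightarrow> 'm::finite \<Rightarrow> 'm \<Rightarrow> complex" and w :: "nat \<Rightarrow> 'm \<Rightarrow> 'd::finite \<Rightarrow> complex"
  assumes u: "\<And>n i. (\<Sum>j\<in>UNIV. (cmod (u n i j))\<^sup>2) = 1"
    and w: "\<And>n i. (\<Sum>k\<in>UNIV. (cmod (w n i k))\<^sup>2) = 1"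
    and \<phi>\<^sub>1: "matrix_state \<phi>\<^sub>1"
  shows "\<exists>\<phi>. is_ehmm_state (\<lambda>n. fork_matrix (u n)) (\<lambda>n. fork_matrix (w n)) \<phi>\<^sub>1 \<phi>"
proof -
  let ?Z = "ehmm_Z (\<lambda>n. fork_matrix (u n)) (\<lambda>n. fork_matrix (w n))"
  define \<Psi> where "\<Psi> = (\<lambda>n i b. config_vec n (\<lambda>\<xi>. path_amplitude u w 0 n i \<xi> b))"
  have comp: "compression (\<Psi> n) (elementary_tensor p (\<lambda>l. mtensor (X l) (Y l))) = ?Z X Y 0 p"
    if "p \<le> n" for n p X Y
  proof -
    \<comment> \<open>Padding with identities turns a product over \<open>p\<close> sites into one
      over \<open>n\<close> sites, where the path expansion applies; the identities are then removed
      from the recursion.\<close>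
    define X' Y' where "X' = (\<lambda>l. if l < p then X l else mat 1)"
      and "Y' = (\<lambda>l. if l < p then Y l else mat 1)"
    have "elementary_tensor p (\<lambda>l. mtensor (X l) (Y l)) = elementary_tensor p (\<lambda>l. mtensor (X' l) (Y' l))"
      by (rule elementary_tensor_cong) (simp add: X'_def Y'_def)
    also have "\<dots> = elementary_tensor n (\<lambda>l. mtensor (X' l) (Y' l))"
      by (rule elementary_tensor_extend[symmetric]) (simp_all add: X'_def Y'_def mtensor_one that)
    also have "compression (\<Psi> n) \<dots> = ?Z X' Y' 0 (p + (n - p))"
      using that by (simp add: \<Psi>_def compression_path_vectors)
    also have "\<dots> = ?Z X' Y' 0 p"
      by (rule ehmm_Z_extend)
        (simp_all add: transition_expectation_fork_matrix_one u w X'_def Y'_def)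
    also have "\<dots> = ?Z X Y 0 p"
      by (rule ehmm_Z_cong) (simp_all add: X'_def Y'_def)
    finally show ?thesis .
  qed
  define \<phi> where "\<phi> = (\<lambda>n T. \<phi>\<^sub>1 (compression (\<Psi> n) T))"
  have st: "op_state infinite_tensor_algebra (\<phi> n)" for n
    unfolding \<phi>_def
  proof (rule op_state_compression[OF \<phi>\<^sub>1])
    \<comment> \<open>The case of no sites: the empty tensor product is the identity operator and
      its \<open>ehmm_Z\<close> is the identity matrix.\<close>
    show "compression (\<Psi> n) id_blinfun = mat 1"
      using comp[of 0 n] by (simp add: elementary_tensor_def local_op_0)
  qed
  have val: "\<phi> n (elementary_tensor p (\<lambda>l. mtensor (X l) (Y l))) = \<phi>\<^sub>1 (?Z X Y 0 p)"
    if "p \<le> n" for n p X Y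
    by (simp add: \<phi>_def comp[OF that])
  \<comment> \<open>For \<open>p \<le> n\<close> the states \<open>\<phi> n\<close> and
    \<open>\<phi> p\<close> have the same values on products over \<open>p\<close> sites, hence on
    all operators local in those sites.\<close>
  have "op_state infinite_tensor_algebra (\<lambda>T. lim (\<lambda>n. \<phi> n T))"
    by (rule op_state_sequence_limit[OF st], rule op_state_local_op_eqI[OF st st]) (simp add: val)
  moreover have "lim (\<lambda>n. \<phi> n (elementary_tensor p (\<lambda>l. mtensor (X l) (Y l)))) = \<phi>\<^sub>1 (?Z X Y 0 p)"
    for p X Y
    by (rule limI, rule tendsto_eventually, rule eventually_sequentiallyI[of p]) (rule val)
  ultimately show ?thesis
    by (auto simp: is_ehmm_state_def)
qed

lemma defines_ehmm_fork_matrix: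
  fixes u :: "nat \<Rightarrow> 'm::finite \<Rightarrow> 'm \<Rightarrow> complex" and w :: "nat \<Rightarrow> 'm \<Rightarrow> 'd::finite \<Rightarrow> complex"
  assumes VH: "\<And>n i. VH n *v axis i 1 = (\<Sum>j\<in>UNIV. u n i j *s vtensor (axis i 1) (axis j 1))"
    and VHO: "\<And>n i. VHO n *v axis i 1 = (\<Sum>k\<in>UNIV. w n i k *s vtensor (axis i 1) (axis k 1))"
    and u: "\<And>n i. (\<Sum>j\<in>UNIV. (cmod (u n i j))\<^sup>2) = 1"
    and w: "\<And>n i. (\<Sum>k\<in>UNIV. (cmod (w n i k))\<^sup>2) = 1"
  shows "defines_ehmm VH VHO"
  unfolding defines_ehmm_def
proof (intro conjI allI impI)
  fix n
  show "\<exists>U. row_stochastic (\<chi> i j. (cmod (U $ i $ j))\<^sup>2) \<and>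
      (\<forall>i. VH n *v axis i 1 = (\<Sum>j\<in>UNIV. U $ i $ j *s vtensor (axis i 1) (axis j 1)))"
    by (rule exI[of _ "\<chi> i j. u n i j"]) (simp add: row_stochastic_def u VH)
  show "\<exists>C. row_stochastic (\<chi> i k. (cmod (C $ i $ k))\<^sup>2) \<and>
      (\<forall>i. VHO n *v axis i 1 = (\<Sum>k\<in>UNIV. C $ i $ k *s vtensor (axis i 1) (axis k 1)))"
    by (rule exI[of _ "\<chi> i k. w n i k"]) (simp add: row_stochastic_def w VHO)
next
  fix \<phi>\<^sub>1 :: "complex ^ 'm ^ 'm \<Rightarrow> complex"
  assume \<phi>\<^sub>1: "matrix_state \<phi>\<^sub>1"
  have "VH = (\<lambda>n. fork_matrix (u n))" "VHO = (\<lambda>n. fork_matrix (w n))"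
    using eq_fork_matrix[OF VH] eq_fork_matrix[OF VHO] by auto
  then obtain \<phi> where \<phi>: "is_ehmm_state VH VHO \<phi>\<^sub>1 \<phi>"
    using is_ehmm_state_exists[of u w, OF u w \<phi>\<^sub>1] by auto
  then show "\<exists>\<phi>. is_ehmm_state VH VHO \<phi>\<^sub>1 \<phi> \<and>
      (\<forall>\<phi>'. is_ehmm_state VH VHO \<phi>\<^sub>1 \<phi>' \<longrightarrow> (\<forall>T\<in>infinite_tensor_algebra. \<phi>' T = \<phi> T))"
    using is_ehmm_state_unique by blast
qed

text \<open>This is the diagonal entry at \<open>i\<close> of the normalisation. Grouping the double
  sum by \<open>j\<close> or by \<open>k\<close> gives the stochasticity of the transition or the
  emission matrix.\<close>

lemma sum_norm_entries_row:
  fixes A :: "'d::finite \<Rightarrow> complex ^ 'm::finite ^ 'm"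
  assumes "(\<Sum>k\<in>UNIV. A k ** dagger (A k)) = mat 1"
  shows "(\<Sum>k\<in>UNIV. \<Sum>j\<in>UNIV. (cmod (A k $ i $ j))\<^sup>2) = 1"
proof -
  have "complex_of_real (\<Sum>k\<in>UNIV. \<Sum>j\<in>UNIV. (cmod (A k $ i $ j))\<^sup>2) =
      (\<Sum>k\<in>UNIV. A k ** dagger (A k)) $ i $ i"
    by (simp add: matrix_matrix_mult_def dagger_def complex_norm_square del: of_real_power)
  also have "\<dots> = 1"
    by (simp add: assms mat_def)
  finally show ?thesis
    by (simp only: of_real_eq_1_iff)
qed

theorem theorem4p1:
  fixes A :: "nat \<Rightarrow> 'd::finite \<Rightarrow> complex ^ 'm::finite ^ 'm"
    and u :: "nat \<Rightarrow> 'm \<Rightarrow> 'm \<Rightarrow> complex"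
    and w :: "nat \<Rightarrow> 'm \<Rightarrow> 'd \<Rightarrow> complex"
    and VH :: "nat \<Rightarrow> complex ^ 'm ^ ('m \<times> 'm)"
    and VHO :: "nat \<Rightarrow> complex ^ 'm ^ ('m \<times> 'd)"
  assumes "\<And>n. (\<Sum>k\<in>UNIV. A n k ** dagger (A n k)) = mat 1"
    and "\<And>n i j. cmod (u n i j) = sqrt (\<Sum>k\<in>UNIV. (cmod (A n k $ i $ j))\<^sup>2)"
    and "\<And>n i k. cmod (w n i k) = sqrt (\<Sum>j\<in>UNIV. (cmod (A n k $ i $ j))\<^sup>2)"
    and "\<And>n i. VH n *v axis i 1 = (\<Sum>j\<in>UNIV. u n i j *s vtensor (axis i 1) (axis j 1))"
    and "\<And>n i. VHO n *v axis i 1 = (\<Sum>k\<in>UNIV. w n i k *s vtensor (axis i 1) (axis k 1))"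
  shows "(\<forall>n. partial_isometry (VH n)) \<and> (\<forall>n. partial_isometry (VHO n)) \<and> defines_ehmm VH VHO"
proof -
  have w: "(\<Sum>k\<in>UNIV. (cmod (w n i k))\<^sup>2) = 1" for n i
    using sum_norm_entries_row[OF assms(1)] by (simp add: assms(3) sum_nonneg)
  \<comment> \<open>The squared moduli of \<open>u\<close> sum over \<open>k\<close> first, so the
    order of summation is exchanged.\<close>
  have u: "(\<Sum>j\<in>UNIV. (cmod (u n i j))\<^sup>2) = 1" for n i
    using sum_norm_entries_row[OF assms(1)] by (subst (asm) sum.swap) (simp add: assms(2) sum_nonneg)
  have "partial_isometry (VH n)" "partial_isometry (VHO n)" for n
    unfolding partial_isometry_def eq_fork_matrix[OF assms(4)] eq_fork_matrix[OF assms(5)]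
    by (simp_all add: fork_matrix_isometry u w)
  then show ?thesis
    using defines_ehmm_fork_matrix[of VH u VHO w, OF assms(4,5) u w] by blast
qed

end
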